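(* Let $N\ge1$ be an integer, let $a:[0,1]\to[0,+\infty)$ be continuous and not identically zero on any subinterval of $[0,1]$, and let $g:[0,+\infty)\to[0,+\infty)$ be continuous with $\lim_{s\to0^+}g(s)/s^N=0$. Consider $$\left((-v')^N\right)'=\lambda^NNr^{N-1}a(r)\left(v^N+g(v)\right),\ r\in(0,1),\qquad v'(0)=v(1)=0. \quad (\ast)$$ Then there exists an unbounded continuum $\mathcal C\subseteq K^+\cup\{(\lambda_1,0)\}$ of solutions to $(\ast)$ emanating from $(\lambda_1,0)$. Moreover, $(\lambda_1,0)$ is the unique bifurcation point from $(\lambda,0)$ of the positive solutions of $(\ast)$.
   Context: $X=C[0,1]$ with the sup norm, $X^+=\{v\in X:v(r)\ge0\}$ with the norm of $X$, $P^+$ is the set of functions in $X^+$ which are positive in $(0,1)$, and $K^+=\mathbb R\times P^+$ with the product topology. Solutions of $(\ast)$ in $\mathbb R\times X^+$ are the pairs $(\lambda,v)$ with $v=\lambda T_gv$, where $T_gv(r)=\int_r^1\left(\int_0^sN\tau^{N-1}a(\tau)\left(v(\tau)^N+g(v(\tau))\right)d\tau\right)^{1/N}ds$. A continuum is a closed connected set; it emanates from $(\lambda_1,0)$ if it contains that point. A bifurcation point from $(\lambda,0)$ of positive solutions is a point $(\lambda,0)$ that is a limit in $\mathbb R\times X^+$ of solutions $(\lambda_n,v_n)$ of $(\ast)$ with $v_n\in P^+$. The number $\lambda_1>0$ is the first (smallest positive) eigenvalue of $\left((-v')^N\right)'=\lambda^NNr^{N-1}a(r)v^N$ in $(0,1)$,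 $v'(0)=v(1)=0$; it is simple, with eigenfunctions (up to sign) positive in $(0,1)$ and concave on $[0,1]$. *)

theory Defs
  imports "HOL-Analysis.Analysis"
begin

text \<open>The compact interval $[0,1]$ as a metric space of its own, so that the library type
  of bounded continuous functions over it is the Banach space $C[0,1]$ with the sup norm.\<close>

typedef unit_interval = "{0..1::real}"
  by (rule exI[of _ 0]) simp

instantiation unit_interval :: metric_space
begin

definition dist_unit_interval :: "unit_interval \<Rightarrow> unit_interval \<Rightarrow> real" where
  "dist_unit_interval x y = dist (Rep_unit_interval x) (Rep_unit_interval y)"

definition uniformity_unit_interval :: "(unit_interval \<times> unit_interval) filter" where
  "uniformity_unit_interval = (INF e\<in>{0<..}. principal {(x, y). dist x y < e})"

definition open_unit_interval :: "unit_interval set \<Rightarrow> bool" where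
  "open_unit_interval U \<longleftrightarrow>
     (\<forall>x\<in>U. eventually (\<lambda>(x', y). x' = x \<longrightarrow> y \<in> U) uniformity)"

instance
proof
  fix x y z :: unit_interval
  show "dist x y = 0 \<longleftrightarrow> x = y"
    by (simp add: dist_unit_interval_def Rep_unit_interval_inject)
  show "dist x y \<le> dist x z + dist y z"
    by (simp add: dist_unit_interval_def dist_triangle2)
qed (simp_all add: uniformity_unit_interval_def open_unit_interval_def)

end

type_synonym C01 = "unit_interval \<Rightarrow>\<^sub>C real"

text \<open>The value $v(r)$ at a real number $r$; only meaningful for $r \in [0,1]$.\<close>

definition val :: "C01 \<Rightarrow> real \<Rightarrow> real" where
  "val v r = apply_bcontfun v (Abs_unit_interval r)"

lemma continuous_on_Rep_unit_interval: "continuous_on UNIV Rep_unit_interval"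
  unfolding continuous_on_iff by (auto simp: dist_unit_interval_def)

lemma continuous_on_Abs_unit_interval: "continuous_on {0..1} Abs_unit_interval"
  unfolding continuous_on_iff
  by (auto simp: dist_unit_interval_def Abs_unit_interval_inverse)

lemma continuous_on_val: "continuous_on {0..1} (val v)"
proof -
  have "continuous_on UNIV (apply_bcontfun v)"
    using apply_bcontfun[of v] by (simp add: bcontfun_def)
  then have "continuous_on {0..1} (\<lambda>r. apply_bcontfun v (Abs_unit_interval r))"
    using continuous_on_Abs_unit_interval continuous_on_compose2 by blast
  then show ?thesis
    by (simp add: val_def[abs_def])
qed

lemma C01_surj:
  assumes "continuous_on {0..1} f"
  shows "\<exists>v::C01. \<forall>r\<in>{0..1}. val v r = f r"
proof -
  let ?h = "\<lambda>x. f (Rep_unit_interval x)"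
  have "continuous_on UNIV ?h"
    using continuous_on_compose2[OF assms continuous_on_Rep_unit_interval] Rep_unit_interval
    by blast
  moreover have "bounded (range ?h)"
  proof (rule bounded_subset)
    show "bounded (f ` {0..1})"
      using assms by (intro compact_imp_bounded compact_continuous_image) auto
    show "range ?h \<subseteq> f ` {0..1}"
      using Rep_unit_interval by blast
  qed
  ultimately have "?h \<in> bcontfun"
    by (simp add: bcontfun_def)
  then have "\<forall>r\<in>{0..1}. val (Bcontfun ?h) r = f r"
    by (simp add: val_def Bcontfun_inverse Abs_unit_interval_inverse)
  then show ?thesis by blast
qed

definition Xplus :: "C01 set" where
  "Xplus = {v. \<forall>r\<in>{0..1}. 0 \<le> val v r}"

definition Pplus :: "C01 set" where
  "Pplus = {v \<in> Xplus. \<forall>r\<in>{0<..<1}. 0 < val v r}"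

definition Kplus :: "(real \<times> C01) set" where
  "Kplus = UNIV \<times> Pplus"

definition Tg :: "nat \<Rightarrow> (real \<Rightarrow> real) \<Rightarrow> (real \<Rightarrow> real) \<Rightarrow> C01 \<Rightarrow> real \<Rightarrow> real" where
  "Tg N a g v r =
     integral {r..1} (\<lambda>s. root N (integral {0..s}
       (\<lambda>\<tau>. real N * \<tau> ^ (N - 1) * a \<tau> * (val v \<tau> ^ N + g (val v \<tau>)))))"

definition solutions ::
  "nat \<Rightarrow> (real \<Rightarrow> real) \<Rightarrow> (real \<Rightarrow> real) \<Rightarrow> (real \<times> C01) set" where
  "solutions N a g =
     {(\<mu>, v). v \<in> Xplus \<and> (\<forall>r\<in>{0..1}. val v r = \<mu> * Tg N a g v r)}"

definition bifurcation_point ::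
  "nat \<Rightarrow> (real \<Rightarrow> real) \<Rightarrow> (real \<Rightarrow> real) \<Rightarrow> real \<times> C01 \<Rightarrow> bool" where
  "bifurcation_point N a g p \<longleftrightarrow>
     snd p = 0 \<and>
     (\<exists>q :: nat \<Rightarrow> real \<times> C01.
        (\<forall>n. q n \<in> solutions N a g \<and> snd (q n) \<in> Pplus) \<and> q \<longlonglongrightarrow> p)"

text \<open>Classical solutions of the eigenvalue problem: $v \in C^1[0,1]$ (one-sided derivatives
  at the end points), of arbitrary sign, with $(-v')^N$ differentiable in $(0,1)$.\<close>

definition eigen_solution ::
  "nat \<Rightarrow> (real \<Rightarrow> real) \<Rightarrow> real \<Rightarrow> (real \<Rightarrow> real) \<Rightarrow> bool" where
  "eigen_solution N a \<mu> v \<longleftrightarrow>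
     (\<exists>v'. continuous_on {0..1} v' \<and>
        (\<forall>r\<in>{0..1}. (v has_real_derivative v' r) (at r within {0..1})) \<and>
        (\<forall>r\<in>{0<..<1}. ((\<lambda>t. (- v' t) ^ N) has_real_derivative
           \<mu> ^ N * real N * r ^ (N - 1) * a r * v r ^ N) (at r)) \<and>
        v' 0 = 0 \<and> v 1 = 0)"

definition eigenvalue :: "nat \<Rightarrow> (real \<Rightarrow> real) \<Rightarrow> real \<Rightarrow> bool" where
  "eigenvalue N a \<mu> \<longleftrightarrow> (\<exists>v. eigen_solution N a \<mu> v \<and> (\<exists>r\<in>{0..1}. v r \<noteq> 0))"

definition first_eigenvalue :: "nat \<Rightarrow> (real \<Rightarrow> real) \<Rightarrow> real" where
  "first_eigenvalue N a = (LEAST \<mu>. 0 < \<mu> \<and> eigenvalue N a \<mu>)"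

end

theory Submission
  imports Defs "HOL-Complex_Analysis.Great_Picard"
begin

text \<open>
  A nontrivial solution is written as $v = s w$ with $s = \|v\|$; since $T_g v$ is nonnegative,
  decreasing and concave, $w$ lies in the convex set of functions between $1 - r$ and $1$, and
  the equation becomes the fixed point problem $w = F(s, w)$, where $F(s, w)$ is
  $T_g(s w)$ divided by its value at 0 and $\lambda$ is recovered as a reciprocal of that value.
  Writing $v^N + g(v) = v^N (1 + \rho(v))$ with $\rho(0) = 0$ extends $F$ continuously to
  $s = 0$, where the fixed point is unique (the positive eigenfunction). Browder's continuum
  theorem joins $s = 0$ to every $s = R$ by a connected set of fixed points, and the map
  $(s, w) \mapsto (\lambda, s w)$ is proper on the fixed point set, which transfers the
  component of $s = 0$ to the required continuum and also shows that no other point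
  $(\lambda, 0)$ is a limit of positive solutions.
\<close>

section \<open>Fixed points of compact maps\<close>

text \<open>Two obstacles shape the argument. For \<open>N\<close> at least 2 the homogeneous
  operator obtained from \<open>g = 0\<close> is not linear, so bifurcation cannot be read off a
  linearization at 0; and \<open>v = 0\<close> solves the equation for every parameter, so a fixed
  point theorem applied to it directly may return nothing else. Dividing by the value at 0 removes
  the trivial branch and makes the amplitude \<open>s\<close>, not the eigenvalue parameter, the
  variable along the continuum. Unboundedness then needs no estimate of the parameter, since the
  norm of \<open>s w\<close> is \<open>s\<close> and every \<open>s\<close> is reached. The chord
  bound \<open>1 - r\<close> also keeps the denominators away from 0 uniformly in \<open>s\<close>.
  Lipschitz constants are controlled only on each range \<open>s\<close> up to \<open>R\<close>, so
  each \<open>R\<close> has its own compact convex set and its own connected set; uniqueness at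
  \<open>s = 0\<close> makes all of these share a point. That uniqueness rests on comparison up to
  the endpoint \<open>r = 1\<close>, where solutions vanish and only gaps of order
  \<open>1 - r\<close> can be exploited.\<close>

lemma compact_Pi_UNIV:
  fixes B :: "'i \<Rightarrow> 'b::topological_space set"
  assumes "\<And>i. compact (B i)"
  shows "compact (Pi UNIV B)"
proof -
  have "compactin (product_topology (\<lambda>_. euclidean) UNIV) (PiE UNIV B)"
    using assms by (subst compactin_PiE) (auto simp: compactin_euclidean_iff)
  then show ?thesis
    by (simp add: euclidean_product_topology compactin_euclidean_iff PiE_UNIV_domain Pi_def)
qed

text \<open>The \<open>n\<close>-dimensional cube inside a sequence space with the product topology.
  The dimension stays an ordinary variable, as it must when it is the size of a finite net found
  inside a proof.\<close>

definition nat_cube :: "nat \<Rightarrow> (nat \<Rightarrow> real) set" where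
  "nat_cube n = Pi UNIV (\<lambda>i. if i < n then {0..1} else {0})"

lemma compact_nat_cube: "compact (nat_cube n)"
  unfolding nat_cube_def by (rule compact_Pi_UNIV) auto

lemma nat_cubeD: "x \<in> nat_cube n \<Longrightarrow> 0 \<le> x i \<and> x i \<le> 1"
  unfolding nat_cube_def Pi_def by (auto dest!: spec[of _ i] split: if_splits)

text \<open>Kuhn's combinatorial lemma on the grid of mesh \<open>1 / p\<close>: some cell carries
  both labels in every coordinate, hence has a vertex \<open>r\<close> where \<open>f\<close> does
  not lower coordinate \<open>i\<close> and a vertex \<open>s\<close> where \<open>f\<close> does
  not raise it. Both vertices depend on \<open>i\<close>.\<close>

lemma nat_cube_approx:
  fixes f :: "(nat \<Rightarrow> real) \<Rightarrow> nat \<Rightarrow> real" and p :: nat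
  assumes maps: "\<And>x i. x \<in> nat_cube n \<Longrightarrow> i < n \<Longrightarrow> f x i \<in> {0..1}" and p: "0 < p"
  shows "\<exists>q\<in>nat_cube n. \<forall>i<n. \<exists>r\<in>nat_cube n. \<exists>s\<in>nat_cube n.
    (\<forall>j. \<bar>r j - q j\<bar> \<le> 1 / p \<and> \<bar>s j - q j\<bar> \<le> 1 / p) \<and> r i \<le> f r i \<and> f s i \<le> s i"
proof -
  define pt :: "(nat \<Rightarrow> nat) \<Rightarrow> nat \<Rightarrow> real" where "pt x = (\<lambda>i. if i < n then x i / p else 0)" for x
  \<comment> \<open>The values on the faces \<open>x i = 0\<close> and \<open>x i = p\<close> are
    those prescribed by Kuhn's lemma; \<open>l0\<close> and \<open>l1\<close> hold there too because
    \<open>f\<close> takes values in the unit interval.\<close>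
  define label :: "(nat \<Rightarrow> nat) \<Rightarrow> nat \<Rightarrow> nat" where
    "label x i = (if x i = 0 then 0 else if x i = p then 1 else if pt x i \<le> f (pt x) i then 0 else 1)"
    for x i
  have pt: "pt x \<in> nat_cube n" if "\<forall>i<n. x i \<le> p" for x
    using that p by (auto simp: pt_def nat_cube_def)
  have l0: "pt x i \<le> f (pt x) i" if "\<forall>i<n. x i \<le> p" "i < n" "label x i = 0" for x i
    using that maps[OF pt[OF that(1)] that(2)] p by (auto simp: label_def pt_def split: if_splits)
  have l1: "f (pt x) i \<le> pt x i" if "\<forall>i<n. x i \<le> p" "i < n" "label x i \<noteq> 0" for x i
    using that maps[OF pt[OF that(1)] that(2)] p by (auto simp: label_def pt_def split: if_splits)
  obtain q where q: "\<forall>i<n. q i < p"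
    and rs: "\<forall>i<n. \<exists>r s. (\<forall>j<n. q j \<le> r j \<and> r j \<le> q j + 1) \<and>
      (\<forall>j<n. q j \<le> s j \<and> s j \<le> q j + 1) \<and> label r i \<noteq> label s i"
    by (rule kuhn_lemma[of p n label]) (use p in \<open>auto simp: label_def\<close>)
  show ?thesis
  proof (rule bexI[of _ "pt q"], rule allI, rule impI)
    show "pt q \<in> nat_cube n"
      using q by (auto intro!: pt less_imp_le)
    fix i assume i: "i < n"
    have *: "\<exists>r s. (\<forall>j<n. q j \<le> r j \<and> r j \<le> q j + 1) \<and>
      (\<forall>j<n. q j \<le> s j \<and> s j \<le> q j + 1) \<and> label r i = 0 \<and> label s i \<noteq> 0"
    proof -
      obtain r s where "(\<forall>j<n. q j \<le> r j \<and> r j \<le> q j + 1)"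
        "(\<forall>j<n. q j \<le> s j \<and> s j \<le> q j + 1)" "label r i \<noteq> label s i"
        using rs i by blast
      then show ?thesis
        by (cases "label r i = 0") (metis, metis label_def zero_neq_one)
    qed
    then obtain r s where r: "\<forall>j<n. q j \<le> r j \<and> r j \<le> q j + 1" and s: "\<forall>j<n. q j \<le> s j \<and> s j \<le> q j + 1"
      and l: "label r i = 0" "label s i \<noteq> 0"
      by blast
    have r': "\<forall>j<n. r j \<le> p" and s': "\<forall>j<n. s j \<le> p"
      using r s q by fastforce+
    have near: "\<bar>pt x j - pt q j\<bar> \<le> 1 / p" if "\<forall>j<n. q j \<le> x j \<and> x j \<le> q j + 1" for x j
    proof (cases "j < n")
      case True
      then have "real (x j) \<le> real (q j) + 1" "real (q j) \<le> real (x j)"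
        using that by force+
      then have "\<bar>real (x j) - real (q j)\<bar> / p \<le> 1 / p"
        using p by (intro divide_right_mono) auto
      then show ?thesis
        using True p by (simp add: pt_def flip: diff_divide_distrib)
    qed (simp add: pt_def)
    show "\<exists>r\<in>nat_cube n. \<exists>s\<in>nat_cube n.
      (\<forall>j. \<bar>r j - pt q j\<bar> \<le> 1 / p \<and> \<bar>s j - pt q j\<bar> \<le> 1 / p) \<and> r i \<le> f r i \<and> f s i \<le> s i"
      by (rule bexI[OF _ pt[OF r']], rule bexI[OF _ pt[OF s']])
        (use near[OF r] near[OF s] l0[OF r' i l(1)] l1[OF s' i l(2)] in blast)
  qed
qed

lemma tendsto_fun_iff:
  "(f \<longlongrightarrow> l) F \<longleftrightarrow> (\<forall>i. ((\<lambda>k. f k i) \<longlongrightarrow> l i) F)" for l :: "'i \<Rightarrow> 'b::topological_space"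
  using limitin_componentwise[of "\<lambda>_. euclidean" UNIV f l F]
  by (simp add: euclidean_product_topology)

lemma tendsto_fun_near:
  fixes q r :: "nat \<Rightarrow> 'i \<Rightarrow> real"
  assumes "q \<longlonglongrightarrow> z" and "\<And>k j. \<bar>r k j - q k j\<bar> \<le> e k" and "e \<longlonglongrightarrow> 0"
  shows "r \<longlonglongrightarrow> z"
  unfolding tendsto_fun_iff
proof
  fix j
  have "(\<lambda>k. r k j - q k j) \<longlonglongrightarrow> 0"
    by (rule Lim_null_comparison[OF _ assms(3)]) (use assms(2) in simp)
  moreover have "(\<lambda>k. q k j) \<longlonglongrightarrow> z j"
    using assms(1) by (simp add: tendsto_fun_iff)
  ultimately show "(\<lambda>k. r k j) \<longlonglongrightarrow> z j"
    using tendsto_add by fastforce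
qed

text \<open>As the mesh tends to 0 along a subsequence, the cells shrink to a point
  \<open>z\<close>, so the vertices chosen for each coordinate converge to the same
  \<open>z\<close>, and continuity turns the two opposite inequalities into an equality.\<close>

lemma brouwer_nat_cube:
  fixes f :: "(nat \<Rightarrow> real) \<Rightarrow> nat \<Rightarrow> real"
  assumes cont: "\<And>i. i < n \<Longrightarrow> continuous_on (nat_cube n) (\<lambda>x. f x i)"
    and maps: "\<And>x i. x \<in> nat_cube n \<Longrightarrow> i < n \<Longrightarrow> f x i \<in> {0..1}"
  shows "\<exists>x\<in>nat_cube n. \<forall>i<n. f x i = x i"
proof -
  have "\<forall>p. \<exists>q\<in>nat_cube n. \<forall>i<n. \<exists>r\<in>nat_cube n. \<exists>s\<in>nat_cube n.
    (\<forall>j. \<bar>r j - q j\<bar> \<le> 1 / Suc p \<and> \<bar>s j - q j\<bar> \<le> 1 / Suc p) \<and> r i \<le> f r i \<and> f s i \<le> s i"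
    using nat_cube_approx[of n f, OF maps] by blast
  then obtain q where q: "\<And>p. q p \<in> nat_cube n"
    and rs: "\<And>p i. i < n \<Longrightarrow> \<exists>r\<in>nat_cube n. \<exists>s\<in>nat_cube n.
    (\<forall>j. \<bar>r j - q p j\<bar> \<le> 1 / Suc p \<and> \<bar>s j - q p j\<bar> \<le> 1 / Suc p) \<and> r i \<le> f r i \<and> f s i \<le> s i"
    by metis
  obtain z k where z: "z \<in> nat_cube n" and k: "strict_mono k" and lim: "(q \<circ> k) \<longlonglongrightarrow> z"
    using compact_nat_cube[of n, unfolded compact_def] q by blast
  have e: "(\<lambda>m. 1 / real (Suc (k m))) \<longlonglongrightarrow> 0"
    using LIMSEQ_subseq_LIMSEQ[OF LIMSEQ_Suc[OF lim_1_over_n] k] by (simp add: o_def)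
  show ?thesis
  proof (intro bexI[OF _ z] allI impI)
    fix i assume i: "i < n"
    obtain r s where r: "\<And>p. r p \<in> nat_cube n" and s: "\<And>p. s p \<in> nat_cube n"
      and near: "\<And>p j. \<bar>r p j - q p j\<bar> \<le> 1 / Suc p" "\<And>p j. \<bar>s p j - q p j\<bar> \<le> 1 / Suc p"
      and le: "\<And>p. r p i \<le> f (r p) i" "\<And>p. f (s p) i \<le> s p i"
      using rs[OF i] by metis
    have rl: "(r \<circ> k) \<longlonglongrightarrow> z" and sl: "(s \<circ> k) \<longlonglongrightarrow> z"
      by (rule tendsto_fun_near[OF lim _ e]; use near in \<open>simp only: o_def\<close>)+
    have fl: "(\<lambda>m. f (x m) i) \<longlonglongrightarrow> f z i" if "x \<longlonglongrightarrow> z" "\<And>m. x m \<in> nat_cube n" for x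
      using cont[OF i] z that by (auto simp: continuous_on_sequentially o_def)
    have "z i \<le> f z i"
      by (rule LIMSEQ_le[OF rl[unfolded tendsto_fun_iff, rule_format] fl[OF rl]])
        (use r le in \<open>auto simp: o_def\<close>)
    moreover have "f z i \<le> z i"
      by (rule LIMSEQ_le[OF fl[OF sl] sl[unfolded tendsto_fun_iff, rule_format]])
        (use s le in \<open>auto simp: o_def\<close>)
    ultimately show "f z i = z i" by simp
  qed
qed

text \<open>Schauder projection: tent functions \<open>m i\<close> around a finite
  \<open>e\<close>-net \<open>b\<close> give a partition of unity \<open>m i / M\<close> on
  \<open>S\<close>. Brouwer's theorem is applied to its values at \<open>f (X t)\<close>, where
  \<open>X t\<close> is a convex combination of the net determined by \<open>t\<close>.\<close>

lemma schauder_approx: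
  fixes f :: "'a::real_normed_vector \<Rightarrow> 'a"
  assumes S: "compact S" "convex S" "S \<noteq> {}" and f: "continuous_on S f" "f ` S \<subseteq> S" and e: "0 < e"
  shows "\<exists>x\<in>S. dist x (f x) \<le> e"
proof -
  have cover: "S \<subseteq> (\<Union>c\<in>S. ball c e)"
    using e by auto
  obtain T where T: "T \<subseteq> S" "finite T" "S \<subseteq> (\<Union>c\<in>T. ball c e)"
    using compactE_image[OF S(1) open_ball cover] .
  obtain n :: nat and b where "T = b ` {i. i < n}"
    using T(2) unfolding finite_conv_nat_seg_image by blast
  then have Tb: "T = b ` {..<n}"
    by (simp add: lessThan_def)
  have n: "0 < n"
  proof (rule ccontr)
    assume "\<not> 0 < n"
    then have "T = {}" using Tb by simp
    then show False using T(3) S(3) by blast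
  qed
  have bS: "b i \<in> S" if "i < n" for i
    using T(1) unfolding Tb using that by blast
  define m where "m i y = max 0 (e - dist y (b i))" for i y
  define M where "M y = (\<Sum>i<n. m i y)" for y
  \<comment> \<open>Points of the cube need not have coordinate sum 1. \<open>w\<close> turns them
    into convex weights: a sum above 1 is divided out, missing mass goes to index 0. If the sum is
    1, \<open>w t\<close> is \<open>t\<close> itself.\<close>
  define w where "w t i = (t i + of_bool (i = 0) * max 0 (1 - sum t {..<n})) / max 1 (sum t {..<n})"
    for t :: "nat \<Rightarrow> real" and i
  define X where "X t = (\<Sum>i<n. w t i *\<^sub>R b i)" for t
  have m0: "0 \<le> m i y" for i y
    by (simp add: m_def)
  have Mpos: "0 < M y" if y: "y \<in> S" for y
  proof -
    obtain i where "i < n" "dist y (b i) < e"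
      using T(3) y unfolding Tb by (auto simp: dist_commute subset_eq)
    then have "0 < m i y" by (simp add: m_def)
    then show ?thesis
      unfolding M_def using \<open>i < n\<close> m0 by (intro sum_pos2[of _ i]) auto
  qed
  have w1: "(\<Sum>i<n. w t i) = 1" for t
  proof -
    have "(\<Sum>i<n. w t i) = (sum t {..<n} + (\<Sum>i<n. of_bool (i = 0) * max 0 (1 - sum t {..<n}))) / max 1 (sum t {..<n})"
      by (simp add: w_def sum.distrib flip: sum_divide_distrib)
    also have "(\<Sum>i<n. of_bool (i = 0) * max 0 (1 - sum t {..<n})) = max 0 (1 - sum t {..<n})"
      using n by (subst sum.remove[of _ 0]) auto
    finally show ?thesis
      by (simp add: max_def split: if_splits)
  qed
  have w0: "0 \<le> w t i" if "t \<in> nat_cube n" for t i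
    unfolding w_def using nat_cubeD[OF that] by (intro divide_nonneg_nonneg add_nonneg_nonneg) auto
  have XS: "X t \<in> S" if "t \<in> nat_cube n" for t
    unfolding X_def using w1 w0[OF that] bS by (intro convex_sum S) auto
  have contt: "continuous_on A (\<lambda>t::nat \<Rightarrow> real. t i)" for A i
    by (rule continuous_on_subset[OF continuous_on_product_coordinates]) simp
  have contX: "continuous_on (nat_cube n) X"
    unfolding X_def w_def by (intro continuous_intros contt) auto
  have contfX: "continuous_on (nat_cube n) (\<lambda>t. f (X t))"
    using continuous_on_compose2[OF f(1) contX] XS by blast
  have fXS: "f (X t) \<in> S" if "t \<in> nat_cube n" for t
    using XS[OF that] f(2) by blast
  have mM: "m i y \<le> M y" if "i < n" for i y
    unfolding M_def using that m0 by (intro member_le_sum) auto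
  have "\<exists>t\<in>nat_cube n. \<forall>i<n. m i (f (X t)) / M (f (X t)) = t i"
  proof (rule brouwer_nat_cube)
    show "continuous_on (nat_cube n) (\<lambda>t. m i (f (X t)) / M (f (X t)))" if "i < n" for i
      unfolding M_def m_def
      by (intro continuous_intros contfX) (use Mpos[OF fXS] in \<open>force simp: M_def m_def\<close>)
    show "m i (f (X t)) / M (f (X t)) \<in> {0..1}" if "t \<in> nat_cube n" "i < n" for t i
      using m0[of i "f (X t)"] mM[OF that(2), of "f (X t)"] Mpos[OF fXS[OF that(1)]] by auto
  qed
  then obtain t where t: "t \<in> nat_cube n" and tfix: "\<And>i. i < n \<Longrightarrow> m i (f (X t)) / M (f (X t)) = t i"
    by blast
  have sum1: "sum t {..<n} = 1"
  proof -
    have "sum t {..<n} = (\<Sum>i<n. m i (f (X t)) / M (f (X t)))"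
      using tfix by (intro sum.cong) auto
    also have "\<dots> = 1"
      using Mpos[OF fXS[OF t]] by (simp add: M_def flip: sum_divide_distrib)
    finally show ?thesis .
  qed
  then have wt: "w t i = t i" for i
    by (simp add: w_def)
  have "norm (X t - f (X t)) = norm (\<Sum>i<n. t i *\<^sub>R (b i - f (X t)))"
    using sum1 by (simp add: X_def wt scaleR_diff_right sum_subtractf flip: scaleR_left.sum)
  also have "\<dots> \<le> (\<Sum>i<n. t i * e)"
  proof (rule order.trans[OF norm_sum], rule sum_mono)
    fix i assume "i \<in> {..<n}"
    then have i: "i < n" by simp
    \<comment> \<open>Only net points within \<open>e\<close> of \<open>f (X t)\<close> carry
      weight, which bounds the weighted average of the differences by \<open>e\<close>.\<close>
    have "t i = 0" if "dist (b i) (f (X t)) \<ge> e"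
      using tfix[OF i] that by (simp add: m_def dist_commute)
    then show "norm (t i *\<^sub>R (b i - f (X t))) \<le> t i * e"
      using nat_cubeD[OF t, of i] by (cases "dist (b i) (f (X t)) \<ge> e") (auto simp: dist_norm intro!: mult_left_mono)
  qed
  also have "\<dots> = e"
    using sum1 by (simp flip: sum_distrib_right)
  finally show ?thesis
    using XS[OF t] by (auto simp: dist_norm)
qed

theorem schauder_fixed_point:
  fixes f :: "'a::real_normed_vector \<Rightarrow> 'a"
  assumes S: "compact S" "convex S" "S \<noteq> {}" and f: "continuous_on S f" "f ` S \<subseteq> S"
  shows "\<exists>x\<in>S. f x = x"
proof -
  have "continuous_on S (\<lambda>x. dist x (f x))"
    using f(1) by (intro continuous_intros)
  then obtain x where x: "x \<in> S" and min: "\<And>y. y \<in> S \<Longrightarrow> dist x (f x) \<le> dist y (f y)"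
    using continuous_attains_inf[OF S(1,3)] by blast
  have "dist x (f x) \<le> e" if "0 < e" for e
    using schauder_approx[OF S f that] min by fastforce
  then have "dist x (f x) = 0"
    using dense_ge[of 0 "dist x (f x)"] by force
  then show ?thesis using x by (metis dist_eq_0_iff)
qed

text \<open>If no connected set of fixed points met both end slices, the compact set
  \<open>S\<close> would split into disjoint closed parts around \<open>A0\<close> and
  \<open>AR\<close>. A Urysohn function for the two parts then yields a self-map of the cylinder
  that contradicts Schauder's theorem.\<close>

theorem browder_continuum:
  fixes F :: "real \<times> 'a::real_normed_vector \<Rightarrow> 'a"
  assumes K: "compact K" "convex K" "K \<noteq> {}" and "0 \<le> R"
    and cont: "continuous_on ({0..R} \<times> K) F" and maps: "F ` ({0..R} \<times> K) \<subseteq> K"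
  shows "\<exists>C. connected C \<and> C \<subseteq> {p \<in> {0..R} \<times> K. F p = snd p} \<and> (\<exists>w. (0, w) \<in> C) \<and> (\<exists>w. (R, w) \<in> C)"
proof (rule ccontr)
  assume none: "\<not> ?thesis"
  define D where "D = {0..R} \<times> K"
  define S where "S = {p \<in> D. F p = snd p}"
  define A0 AR where "A0 = S \<inter> ({0} \<times> UNIV)" and "AR = S \<inter> ({R} \<times> UNIV)"
  have D: "compact D" "convex D" "D \<noteq> {}"
    unfolding D_def using K \<open>0 \<le> R\<close> by (auto intro: compact_Times convex_Times)
  have contD: "continuous_on D F" and mapsD: "\<And>p. p \<in> D \<Longrightarrow> F p \<in> K"
    using cont maps by (auto simp: D_def)
  have "closed S"
    unfolding S_def using D(1) contD
    by (intro continuous_closed_preimage_constant[where a=0 and f="\<lambda>p. F p - snd p", simplified] continuous_intros compact_imp_closed)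
  then have S: "compact S"
    using compact_Int_closed[OF D(1), of S] by (simp add: S_def Int_absorb1 Collect_mono_iff inf.absorb2 subset_eq)
  have A0: "compact A0" and AR: "compact AR"
    unfolding A0_def AR_def using S by (auto intro!: compact_Int_closed closed_Times)
  let ?X = "top_of_set S"
  have lc: "locally_compact_space ?X" and hd: "Hausdorff_space ?X"
    using S by (auto intro!: compact_imp_locally_compact_space Hausdorff_space_subtopology simp: compact_space_subtopology)
  have "separated_between ?X A0 AR"
  proof -
    \<comment> \<open>In a compact Hausdorff space a component disjoint from a closed set can be cut
      off from it by a clopen set; compactness of \<open>A0\<close> then combines the cuts made for
      its points.\<close>
    have "separated_between ?X {x} AR" if x: "x \<in> A0" for x
    proof -
      let ?C = "connected_component_of_set ?X x"
      have xS: "x \<in> S" using x by (auto simp: A0_def)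
      have "connectedin ?X ?C"
        by (rule connectedin_connected_component_of)
      then have C: "connected ?C" "?C \<subseteq> S"
        by (auto simp: connectedin_subtopology)
      have xC: "x \<in> ?C"
        using xS by (simp add: connected_component_of_refl)
      obtain w where "x = (0, w)" using x by (auto simp: A0_def)
      then have "\<And>w. (R, w) \<notin> ?C"
        using none C xC unfolding S_def D_def by blast
      then have "disjnt ?C AR"
        by (auto simp: disjnt_def AR_def)
      moreover have "?C \<in> connected_components_of ?X"
        using xS by (simp add: connected_component_in_connected_components_of)
      moreover have "compactin ?X ?C"
        using S by (intro closedin_compact_space) (auto simp: compact_space_subtopology closedin_connected_component_of)
      moreover have "closedin ?X AR"
        using AR by (auto simp: AR_def intro!: closed_subset compact_imp_closed)
      ultimately have "separated_between ?X ?C AR"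
        using lc hd by (intro separated_between_compact_connected_component) auto
      then show ?thesis
        using separated_between_mono xC by blast
    qed
    moreover have "compactin ?X A0" "AR \<subseteq> S"
      using A0 by (auto simp: A0_def AR_def compactin_subtopology)
    ultimately show ?thesis
      by (subst separated_between_pointwise_left) auto
  qed
  then obtain A B where AB: "closedin ?X A" "closedin ?X B" "A \<union> B = S" "A \<inter> B = {}" "A0 \<subseteq> A" "AR \<subseteq> B"
    by (auto simp: separated_between_alt disjnt_def)
  have clA: "closed A" and clB: "closed B"
    using AB(1,2) S by (auto intro: closedin_closed_trans compact_imp_closed)
  \<comment> \<open>The orientation is reversed on purpose: 1 on the part containing the slice at 0,
    and 0 on the part containing the slice at \<open>R\<close>, so \<open>R * \<theta> p\<close>
    points to the opposite end.\<close>
  have "\<exists>\<theta>. continuous_on D \<theta> \<and> (\<forall>p\<in>D. \<theta> p \<in> {0..1::real}) \<and> (\<forall>p\<in>A. \<theta> p = 1) \<and> (\<forall>p\<in>B. \<theta> p = 0)"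
  proof -
    have "normal_space (euclidean :: (real \<times> 'a) topology)"
      using metrizable_imp_normal_space metrizable_space_euclidean by blast
    then obtain \<theta> where "continuous_map euclidean (top_of_set {0..1::real}) \<theta>" "\<theta> ` B \<subseteq> {0}" "\<theta> ` A \<subseteq> {1}"
      using Urysohn_lemma[of euclidean B A 0 "1::real"] clA clB AB(4) by (auto simp: disjnt_def)
    then show ?thesis
      by (intro exI[of _ \<theta>]) (auto simp: continuous_map_in_subtopology intro: continuous_on_subset)
  qed
  then obtain \<theta> where \<theta>: "continuous_on D \<theta>" "\<And>p. p \<in> D \<Longrightarrow> \<theta> p \<in> {0..1::real}"
    "\<And>p. p \<in> A \<Longrightarrow> \<theta> p = 1" "\<And>p. p \<in> B \<Longrightarrow> \<theta> p = 0"
    by blast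
  \<comment> \<open>A fixed point of this map lies in \<open>S\<close>, but on \<open>A\<close> it would have first
    coordinate \<open>R\<close> and on \<open>B\<close> first coordinate 0.\<close>
  have "\<exists>p\<in>D. (R * \<theta> p, F p) = p"
  proof (rule schauder_fixed_point[OF D])
    show "continuous_on D (\<lambda>p. (R * \<theta> p, F p))"
      using \<theta>(1) contD by (intro continuous_intros)
    have "R * \<theta> p \<in> {0..R}" if "p \<in> D" for p
      using \<theta>(2)[OF that] \<open>0 \<le> R\<close> by (auto simp: mult_left_le)
    then show "(\<lambda>p. (R * \<theta> p, F p)) ` D \<subseteq> D"
      using mapsD by (auto simp: D_def)
  qed
  then obtain p where p: "p \<in> D" "fst p = R * \<theta> p" "snd p = F p"
    by (metis fst_conv snd_conv)
  then have "p \<in> S" by (simp add: S_def)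
  then consider "p \<in> A" | "p \<in> B" using AB(3) by blast
  then show False
  proof cases
    case 1
    then have "p \<in> AR"
      using p \<theta>(3) \<open>p \<in> S\<close> by (cases p) (auto simp: AR_def)
    then show False using 1 AB by blast
  next
    case 2
    then have "p \<in> A0"
      using p \<theta>(4) \<open>p \<in> S\<close> by (cases p) (auto simp: A0_def)
    then show False using 2 AB by blast
  qed
qed

section \<open>Normalized profiles in C[0,1]\<close>

lemma val_0 [simp]: "val 0 r = 0" and val_scaleR [simp]: "val (c *\<^sub>R v) r = c * val v r"
  and val_add [simp]: "val (v + w) r = val v r + val w r"
  and val_diff [simp]: "val (v - w) r = val v r - val w r"
  by (simp_all add: val_def)

lemma abs_val_le_norm: "\<bar>val v r\<bar> \<le> norm v"
  using norm_bounded[of v "Abs_unit_interval r"] by (simp add: val_def)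

lemma norm_C01_le:
  assumes "\<And>r. r \<in> {0..1} \<Longrightarrow> \<bar>val v r\<bar> \<le> b"
  shows "norm v \<le> b"
proof (rule norm_bound)
  fix x show "norm (apply_bcontfun v x) \<le> b"
    using assms[OF Rep_unit_interval[of x]] by (simp add: val_def Rep_unit_interval_inverse)
qed

lemma C01_eqI:
  assumes "\<And>r. r \<in> {0..1} \<Longrightarrow> val v r = val w r"
  shows "v = w"
  using norm_C01_le[of "v - w" 0] assms by simp

definition C01_of :: "(real \<Rightarrow> real) \<Rightarrow> C01" where
  "C01_of f = (SOME v. \<forall>r\<in>{0..1}. val v r = f r)"

lemma val_C01_of: "continuous_on {0..1} f \<Longrightarrow> r \<in> {0..1} \<Longrightarrow> val (C01_of f) r = f r"
  using someI_ex[OF C01_surj[of f]] by (simp add: C01_of_def)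

lemma continuous_val: "continuous_on A (\<lambda>v. val v r)"
proof (rule continuous_onI)
  fix x e assume "0 < (e::real)"
  then show "\<exists>d>0. \<forall>x'\<in>A. dist x' x < d \<longrightarrow> dist (val x' r) (val x r) \<le> e"
    using abs_val_le_norm[of "_ - x" r]
    by (intro exI[of _ e]) (force simp: dist_norm intro: order.trans less_imp_le)
qed

lemma tendsto_val: "v \<longlonglongrightarrow> w \<Longrightarrow> (\<lambda>n. val (v n) r) \<longlonglongrightarrow> val w r"
  using continuous_on_tendsto_compose[OF continuous_val[of UNIV r]] by auto

text \<open>Normalized profiles: nonnegative concave functions on the unit interval with maximum
  1 at 0 lie above the chord, so the convex set below stands in for the unit sphere of
  the sup norm, which is not convex.\<close>

definition profiles :: "C01 set" where
  "profiles = {w. \<forall>r\<in>{0..1}. val w r \<in> {1 - r..1}}"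

text \<open>A common Lipschitz constant supplies the equicontinuity that \<open>profiles\<close>
  lacks while keeping convexity, so Schauder's theorem applies here.\<close>

definition lip_profiles :: "real \<Rightarrow> C01 set" where
  "lip_profiles M = {w \<in> profiles. \<forall>r\<in>{0..1}. \<forall>s\<in>{0..1}. \<bar>val w r - val w s\<bar> \<le> M * \<bar>r - s\<bar>}"

lemma profilesD:
  assumes "w \<in> profiles" "r \<in> {0..1}"
  shows "1 - r \<le> val w r" "val w r \<le> 1" "0 \<le> val w r"
proof -
  show "1 - r \<le> val w r" "val w r \<le> 1"
    using assms by (auto simp: profiles_def)
  then show "0 \<le> val w r"
    using assms(2) by auto
qed

text \<open>The two bounds on a profile meet at \<open>r = 0\<close>. Consequently the amplitude
  \<open>s\<close> of \<open>s w\<close> can be recovered as a norm.\<close>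

lemma norm_profile: "w \<in> profiles \<Longrightarrow> norm w = 1"
proof (rule antisym)
  assume w: "w \<in> profiles"
  show "norm w \<le> 1"
    using profilesD(2,3)[OF w] by (intro norm_C01_le) auto
  show "1 \<le> norm w"
    using profilesD(1)[OF w, of 0] abs_val_le_norm[of w 0] by simp
qed

lemma profile_at_0: "w \<in> profiles \<Longrightarrow> val w 0 = 1"
  using profilesD[of w 0] by simp

lemma closed_profiles: "closed profiles"
proof -
  have "profiles = (\<Inter>r\<in>{0..1}. {w. 1 - r \<le> val w r} \<inter> {w. val w r \<le> 1})"
    by (auto simp: profiles_def)
  also have "closed \<dots>"
    by (intro closed_INT ballI closed_Int closed_Collect_le continuous_val continuous_intros)
  finally show ?thesis .
qed

lemma convex_profiles: "convex profiles"
  unfolding convex_alt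
proof (intro ballI allI impI)
  fix v w :: C01 and u :: real
  assume v: "v \<in> profiles" and w: "w \<in> profiles" and u: "0 \<le> u \<and> u \<le> 1"
  have "val ((1 - u) *\<^sub>R v + u *\<^sub>R w) r \<in> {1 - r..1}" if "r \<in> {0..1}" for r
    using convexD_alt[OF convex_real_interval(5)[of "1 - r" 1], of "val v r" "val w r" u]
      profilesD[OF v that] profilesD[OF w that] u by auto
  then show "(1 - u) *\<^sub>R v + u *\<^sub>R w \<in> profiles"
    by (simp add: profiles_def)
qed

lemma convex_lip_profiles: "convex (lip_profiles M)"
  unfolding convex_alt
proof (intro ballI allI impI)
  fix v w :: C01 and u :: real
  assume v: "v \<in> lip_profiles M" and w: "w \<in> lip_profiles M" and u: "0 \<le> u \<and> u \<le> 1"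
  have "\<bar>val ((1 - u) *\<^sub>R v + u *\<^sub>R w) r - val ((1 - u) *\<^sub>R v + u *\<^sub>R w) s\<bar> \<le> M * \<bar>r - s\<bar>"
    if "r \<in> {0..1}" "s \<in> {0..1}" for r s
  proof -
    have "val ((1 - u) *\<^sub>R v + u *\<^sub>R w) r - val ((1 - u) *\<^sub>R v + u *\<^sub>R w) s
      = (1 - u) * (val v r - val v s) + u * (val w r - val w s)"
      by (simp add: algebra_simps)
    also have "\<bar>\<dots>\<bar> \<le> (1 - u) * \<bar>val v r - val v s\<bar> + u * \<bar>val w r - val w s\<bar>"
      using u by (intro order.trans[OF abs_triangle_ineq]) (simp add: abs_mult)
    also have "\<dots> \<le> (1 - u) * (M * \<bar>r - s\<bar>) + u * (M * \<bar>r - s\<bar>)"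
      using u v w that by (intro add_mono mult_left_mono) (auto simp: lip_profiles_def)
    finally show ?thesis by (simp add: algebra_simps)
  qed
  then show "(1 - u) *\<^sub>R v + u *\<^sub>R w \<in> lip_profiles M"
    using convexD_alt[OF convex_profiles, of v w u] u v w by (simp add: lip_profiles_def)
qed

lemma compact_lip_profiles: "compact (lip_profiles M)"
  unfolding compact_def
proof (intro allI impI)
  fix w :: "nat \<Rightarrow> C01" assume w: "\<forall>n. w n \<in> lip_profiles M"
  have wp: "w n \<in> profiles" for n
    using w by (simp add: lip_profiles_def)
  have lip: "\<bar>val (w n) r - val (w n) s\<bar> \<le> M * \<bar>r - s\<bar>" if "r \<in> {0..1}" "s \<in> {0..1}" for n r s
    using w that by (simp add: lip_profiles_def)
  obtain g k where g: "continuous_on {0..1} g" and k: "strict_mono (k :: nat \<Rightarrow> nat)"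
    and unif: "\<And>e. 0 < e \<Longrightarrow> \<exists>n0. \<forall>n r. n \<ge> n0 \<and> r \<in> {0..1} \<longrightarrow> norm (val (w (k n)) r - g r) < e"
  proof (rule Arzela_Ascoli[of "{0..1}" "\<lambda>n. val (w n)" 1])
    show "norm (val (w n) r) \<le> 1" if "r \<in> {0..1}" for n r
      using profilesD[OF wp that] by simp
    show "\<exists>d>0. \<forall>n s. s \<in> {0..1} \<and> norm (r - s) < d \<longrightarrow> norm (val (w n) r - val (w n) s) < e"
      if r: "r \<in> {0..1}" and e: "0 < e" for r e
    proof (intro exI conjI allI impI)
      \<comment> \<open>\<open>\<bar>M\<bar> + 1\<close> is positive whatever the sign of
        \<open>M\<close>.\<close>
      show "0 < e / (\<bar>M\<bar> + 1)" using e by simp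
      fix n s assume s: "s \<in> {0..1} \<and> norm (r - s) < e / (\<bar>M\<bar> + 1)"
      have "\<bar>val (w n) r - val (w n) s\<bar> \<le> M * \<bar>r - s\<bar>"
        using lip r s by blast
      also have "\<dots> \<le> (\<bar>M\<bar> + 1) * \<bar>r - s\<bar>"
        by (intro mult_right_mono) auto
      also have "\<dots> < e"
        using s by (simp add: field_simps)
      finally show "norm (val (w n) r - val (w n) s) < e" by simp
    qed
  qed auto
  define v where "v = C01_of g"
  have v: "val v r = g r" if "r \<in> {0..1}" for r
    using val_C01_of[OF g that] by (simp add: v_def)
  have lim: "(w \<circ> k) \<longlonglongrightarrow> v"
  proof (rule LIMSEQ_I)
    fix e :: real assume "0 < e"
    then obtain n0 where n0: "\<And>n r. n \<ge> n0 \<Longrightarrow> r \<in> {0..1} \<Longrightarrow> norm (val (w (k n)) r - g r) < e / 2"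
      using unif[of "e / 2"] by auto
    show "\<exists>no. \<forall>n\<ge>no. norm ((w \<circ> k) n - v) < e"
    proof (intro exI allI impI)
      fix n assume "n0 \<le> n"
      then have "norm ((w \<circ> k) n - v) \<le> e / 2"
        using n0 v by (intro norm_C01_le) (auto intro: less_imp_le)
      then show "norm ((w \<circ> k) n - v) < e" using \<open>0 < e\<close> by simp
    qed
  qed
  have lim': "(\<lambda>n. val (w (k n)) r) \<longlonglongrightarrow> val v r" for r
    using tendsto_val[OF lim] by (simp add: o_def)
  have "v \<in> profiles"
    using closed_sequentially[OF closed_profiles _ lim] wp by simp
  moreover have "\<bar>val v r - val v s\<bar> \<le> M * \<bar>r - s\<bar>" if "r \<in> {0..1}" "s \<in> {0..1}" for r s
    by (rule LIMSEQ_le_const2[OF tendsto_rabs[OF tendsto_diff[OF lim' lim']]]) (use lip that in blast)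
  ultimately have "v \<in> lip_profiles M"
    by (simp add: lip_profiles_def)
  then show "\<exists>l\<in>lip_profiles M. \<exists>r. strict_mono r \<and> (w \<circ> r) \<longlonglongrightarrow> l"
    using k lim by blast
qed

text \<open>Superadditivity of the power, wanted in its equivalent form: \<open>root N\<close> is
  subadditive.\<close>

lemma add_power_le:
  fixes x y :: real
  assumes "0 \<le> x" "0 \<le> y" "1 \<le> n"
  shows "x ^ n + y ^ n \<le> (x + y) ^ n"
  using assms(3)
proof (induction n rule: dec_induct)
  case (step n)
  have "x ^ Suc n + y ^ Suc n \<le> (x + y) * (x ^ n + y ^ n)"
    using assms by (simp add: algebra_simps)
  also have "\<dots> \<le> (x + y) * (x + y) ^ n"
    using assms step.IH by (intro mult_left_mono) auto
  finally show ?case by simp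
qed simp

section \<open>The integral operator\<close>

locale weight =
  fixes N :: nat and p :: "real \<Rightarrow> real"
  assumes N: "1 \<le> N" and p_cont: "continuous_on {0..1} p"
    and p_nonneg: "\<And>r. r \<in> {0..1} \<Longrightarrow> 0 \<le> p r"
    and p_nontriv: "\<And>c d. 0 \<le> c \<Longrightarrow> c < d \<Longrightarrow> d \<le> 1 \<Longrightarrow> \<exists>r\<in>{c<..<d}. p r \<noteq> 0"
begin

text \<open>For nonnegative continuous \<open>u\<close>, \<open>J u\<close> is the nonincreasing
  solution \<open>w\<close> of \<open>((-w')^N)' = p u\<close>, \<open>w'(0) = w(1) = 0\<close>, and
  \<open>slope u\<close> is \<open>-w'\<close>. Taking the right-hand side as argument lets one
  operator serve both the nonlinear problem and the eigenvalue problem.\<close>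

definition slope :: "(real \<Rightarrow> real) \<Rightarrow> real \<Rightarrow> real" where
  "slope u r = root N (integral {0..r} (\<lambda>t. p t * u t))"

definition J :: "(real \<Rightarrow> real) \<Rightarrow> real \<Rightarrow> real" where
  "J u r = integral {r..1} (slope u)"

definition nonneg_cont :: "(real \<Rightarrow> real) \<Rightarrow> bool" where
  "nonneg_cont u \<longleftrightarrow> continuous_on {0..1} u \<and> (\<forall>r\<in>{0..1}. 0 \<le> u r)"

section \<open>Order, homogeneity and concavity of the operator\<close>

lemma N_pos: "0 < N"
  using N by simp

lemma nonneg_cont_D: "nonneg_cont u \<Longrightarrow> continuous_on {0..1} u" "nonneg_cont u \<Longrightarrow> r \<in> {0..1} \<Longrightarrow> 0 \<le> u r"
  by (simp_all add: nonneg_cont_def)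

lemma nonneg_cont_power: "nonneg_cont u \<Longrightarrow> nonneg_cont (\<lambda>r. u r ^ n)"
  by (auto simp: nonneg_cont_def intro: continuous_intros)

lemma nonneg_cont_cmult: "nonneg_cont u \<Longrightarrow> 0 \<le> c \<Longrightarrow> nonneg_cont (\<lambda>r. c * u r)"
  by (auto simp: nonneg_cont_def intro: continuous_intros)

lemma cont_pu: "continuous_on {0..1} u \<Longrightarrow> A \<subseteq> {0..1} \<Longrightarrow> continuous_on A (\<lambda>t. p t * u t)"
  using p_cont by (auto intro: continuous_intros continuous_on_subset)

lemma int_pu: "continuous_on {0..1} u \<Longrightarrow> 0 \<le> r \<Longrightarrow> s \<le> 1 \<Longrightarrow> (\<lambda>t. p t * u t) integrable_on {r..s}"
  by (intro integrable_continuous_real cont_pu) auto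

lemma primitive_nonneg:
  assumes "nonneg_cont u" "r \<in> {0..1}"
  shows "0 \<le> integral {0..r} (\<lambda>t. p t * u t)"
  using assms p_nonneg by (intro integral_nonneg int_pu) (auto simp: nonneg_cont_def)

lemma slope_power: "nonneg_cont u \<Longrightarrow> r \<in> {0..1} \<Longrightarrow> slope u r ^ N = integral {0..r} (\<lambda>t. p t * u t)"
  unfolding slope_def using primitive_nonneg N_pos by (simp add: real_root_pow_pos2)

lemma slope_nonneg: "nonneg_cont u \<Longrightarrow> r \<in> {0..1} \<Longrightarrow> 0 \<le> slope u r"
  unfolding slope_def using primitive_nonneg by (simp add: real_root_ge_zero)

lemma slope_cont: "continuous_on {0..1} u \<Longrightarrow> continuous_on {0..1} (slope u)"
  unfolding slope_def
  by (intro continuous_intros indefinite_integral_continuous_1 int_pu) auto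

lemma slope_int: "continuous_on {0..1} u \<Longrightarrow> 0 \<le> r \<Longrightarrow> s \<le> 1 \<Longrightarrow> slope u integrable_on {r..s}"
  by (intro integrable_continuous_real continuous_on_subset[OF slope_cont]) auto

lemma slope_mono_arg:
  assumes u: "nonneg_cont u" and rs: "0 \<le> r" "r \<le> s" "s \<le> 1"
  shows "slope u r \<le> slope u s"
  unfolding slope_def
proof (rule real_root_le_mono[OF N_pos], rule integral_subset_le)
  show "\<forall>t\<in>{0..s}. 0 \<le> p t * u t"
    using rs p_nonneg nonneg_cont_D(2)[OF u] by simp
qed (use rs nonneg_cont_D(1)[OF u] in \<open>auto intro: int_pu\<close>)

lemma slope_mono:
  assumes u: "continuous_on {0..1} u" "continuous_on {0..1} v" and le: "\<And>t. t \<in> {0..1} \<Longrightarrow> u t \<le> v t"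
    and r: "r \<in> {0..1}"
  shows "slope u r \<le> slope v r"
  unfolding slope_def
  using r by (intro real_root_le_mono[OF N_pos] integral_le int_pu u mult_left_mono le p_nonneg) auto

text \<open>The root undoes the power, so sending \<open>u\<close> to \<open>J\<close> of
  \<open>u ^ N\<close> is positively homogeneous of degree 1 on nonnegative functions. Comparison
  arguments known from linear eigenvalue problems therefore survive.\<close>

lemma slope_cmult:
  assumes "0 \<le> c"
  shows "slope (\<lambda>t. c ^ N * u t) r = c * slope u r"
proof -
  have "slope (\<lambda>t. c ^ N * u t) r = root N (c ^ N * integral {0..r} (\<lambda>t. p t * u t))"
    unfolding slope_def by (simp add: mult.left_commute flip: integral_mult_right)
  then show ?thesis
    using assms N_pos by (simp add: slope_def real_root_mult real_root_power_cancel)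
qed

lemma slope_cong: "(\<And>t. t \<in> {0..1} \<Longrightarrow> u t = v t) \<Longrightarrow> r \<le> 1 \<Longrightarrow> slope u r = slope v r"
  unfolding slope_def by (intro arg_cong[where f="root N"] integral_cong) auto

lemma J_cong: "(\<And>t. t \<in> {0..1} \<Longrightarrow> u t = v t) \<Longrightarrow> 0 \<le> r \<Longrightarrow> J u r = J v r"
  unfolding J_def by (intro integral_cong slope_cong) auto

lemma J_cmult:
  assumes "0 \<le> c"
  shows "J (\<lambda>t. c ^ N * u t) r = c * J u r"
proof -
  have "slope (\<lambda>t. c ^ N * u t) = (\<lambda>r. c * slope u r)"
    using slope_cmult[OF assms] by (intro ext)
  then show ?thesis by (simp add: J_def)
qed

lemma J_at_1 [simp]: "J u 1 = 0"
  by (simp add: J_def)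

lemma J_split: "continuous_on {0..1} u \<Longrightarrow> 0 \<le> r \<Longrightarrow> r \<le> s \<Longrightarrow> s \<le> 1 \<Longrightarrow> J u r = integral {r..s} (slope u) + J u s"
  unfolding J_def by (intro Henstock_Kurzweil_Integration.integral_combine[symmetric] slope_int) auto

lemma integral_slope_bounds:
  assumes u: "nonneg_cont u" and rs: "0 \<le> r" "r \<le> s" "s \<le> 1"
  shows "(s - r) * slope u r \<le> integral {r..s} (slope u)" "integral {r..s} (slope u) \<le> (s - r) * slope u s"
proof -
  have "integral {r..s} (\<lambda>_. slope u r) \<le> integral {r..s} (slope u)"
    using rs by (intro integral_le slope_int nonneg_cont_D[OF u]) (auto intro: slope_mono_arg[OF u])
  moreover have "integral {r..s} (slope u) \<le> integral {r..s} (\<lambda>_. slope u s)"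
    using rs by (intro integral_le slope_int nonneg_cont_D[OF u]) (auto intro: slope_mono_arg[OF u])
  ultimately show "(s - r) * slope u r \<le> integral {r..s} (slope u)"
    "integral {r..s} (slope u) \<le> (s - r) * slope u s"
    using rs by simp_all
qed

lemma J_lip1:
  assumes u: "nonneg_cont u" and rs: "0 \<le> r" "r \<le> s" "s \<le> 1"
  shows "J u s \<le> J u r" "J u r - J u s \<le> slope u 1 * (s - r)"
proof -
  have "0 \<le> (s - r) * slope u r"
    using rs slope_nonneg[OF u, of r] by simp
  then show "J u s \<le> J u r"
    using integral_slope_bounds(1)[OF u rs] J_split[OF nonneg_cont_D(1)[OF u] rs] by simp
  have "(s - r) * slope u s \<le> (s - r) * slope u 1"
    using rs by (intro mult_left_mono slope_mono_arg[OF u]) auto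
  then show "J u r - J u s \<le> slope u 1 * (s - r)"
    using integral_slope_bounds(2)[OF u rs] J_split[OF nonneg_cont_D(1)[OF u] rs] by (simp add: mult.commute)
qed

lemma J_lip:
  assumes u: "nonneg_cont u" and "r \<in> {0..1}" "s \<in> {0..1}"
  shows "\<bar>J u r - J u s\<bar> \<le> slope u 1 * \<bar>r - s\<bar>"
  using J_lip1[OF u, of r s] J_lip1[OF u, of s r] assms(2,3) by (cases "r \<le> s") auto

lemma J_cont: "continuous_on {0..1} u \<Longrightarrow> continuous_on {0..1} (J u)"
  unfolding J_def by (intro indefinite_integral_continuous_1' slope_int) auto

lemma J_nonneg: "nonneg_cont u \<Longrightarrow> r \<in> {0..1} \<Longrightarrow> 0 \<le> J u r"
  using J_lip1(1)[of u r 1] by simp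

lemma J_upper: "nonneg_cont u \<Longrightarrow> r \<in> {0..1} \<Longrightarrow> J u r \<le> slope u 1 * (1 - r)"
  using J_lip1(2)[of u r 1] by simp

text \<open>Concavity of \<^term>\<open>J u\<close> enters only through this chord estimate.\<close>

lemma J_chord:
  assumes u: "nonneg_cont u" and r: "r \<in> {0..1}"
  shows "(1 - r) * J u 0 \<le> J u r"
proof -
  have "J u 0 = integral {0..r} (slope u) + J u r"
    using r by (intro J_split nonneg_cont_D[OF u]) auto
  moreover have "integral {0..r} (slope u) \<le> r * slope u r"
    using integral_slope_bounds(2)[OF u, of 0 r] r by simp
  moreover have "(1 - r) * slope u r \<le> J u r"
    unfolding J_def using integral_slope_bounds(1)[OF u, of r 1] r by simp
  ultimately have "(1 - r) * J u 0 \<le> (1 - r) * (r * slope u r + J u r)"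
    "r * ((1 - r) * slope u r) \<le> r * J u r"
    using r by (auto intro!: mult_left_mono)
  then show ?thesis by (simp add: algebra_simps)
qed

lemma J_mono:
  assumes u: "continuous_on {0..1} u" "continuous_on {0..1} v" and le: "\<And>t. t \<in> {0..1} \<Longrightarrow> u t \<le> v t"
    and r: "r \<in> {0..1}"
  shows "J u r \<le> J v r"
  unfolding J_def using r by (intro integral_le slope_int u slope_mono[OF u le]) auto

text \<open>Continuity spreads the strict inequality from \<open>x\<close> to an interval, on which
  \<open>p\<close> is not identically 0; the resulting gap between the primitives persists for all
  larger arguments.\<close>

lemma slope_strict:
  assumes u: "nonneg_cont u" and v: "nonneg_cont v" and le: "\<And>t. t \<in> {0..1} \<Longrightarrow> u t \<le> v t"
    and x: "x \<in> {0..1}" "u x < v x"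
  shows "\<exists>s0. 0 \<le> s0 \<and> s0 < 1 \<and> (\<forall>s\<in>{s0..1}. slope u s < slope v s)"
proof -
  note uc = nonneg_cont_D(1)[OF u] and vc = nonneg_cont_D(1)[OF v]
  have "continuous_on {0..1} (\<lambda>t. v t - u t)"
    using uc vc by (intro continuous_intros)
  then obtain d where d: "0 < d" and near: "\<And>t. t \<in> {0..1} \<Longrightarrow> dist t x < d \<Longrightarrow> dist (v t - u t) (v x - u x) < v x - u x"
    using x unfolding continuous_on_iff by (metis diff_gt_0_iff_gt)
  have lt: "u t < v t" if "t \<in> {0..1}" "\<bar>t - x\<bar> < d" for t
    using near[of t] that by (auto simp: dist_real_def)
  \<comment> \<open>The right end \<open>e\<close> must stay below 1 so that an interval of positive
    length remains beyond it; for \<open>x = 1\<close> the interval is therefore taken to the left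
    of \<open>x\<close>.\<close>
  have "\<exists>c e. 0 \<le> c \<and> c < e \<and> e < 1 \<and> (\<forall>t\<in>{c<..<e}. u t < v t)"
  proof (cases "x < 1")
    case True
    then show ?thesis
      using x d by (intro exI[of _ x] exI[of _ "min (x + d) ((1 + x) / 2)"]) (auto intro!: lt simp: min_def)
  next
    case False
    then show ?thesis
      using x d by (intro exI[of _ "max 0 (1 - d)"] exI[of _ "max (1/2) (1 - d / 2)"]) (auto intro!: lt simp: max_def split: if_splits)
  qed
  then obtain c e where ce: "0 \<le> c" "c < e" "e < 1" and lt': "\<And>t. t \<in> {c<..<e} \<Longrightarrow> u t < v t"
    by blast
  obtain y where y: "y \<in> {c<..<e}" "p y \<noteq> 0"
    using p_nontriv[of c e] ce by auto
  have "slope u s < slope v s" if s: "s \<in> {e..1}" for s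
  proof -
    let ?h = "\<lambda>t. p t * (v t - u t)"
    have c: "continuous_on {0..s} ?h"
      using s ce uc vc by (intro cont_pu continuous_intros) auto
    have h0: "0 \<le> ?h t" if "t \<in> {0..s}" for t
      using that s ce p_nonneg le by simp
    have "?h y \<noteq> 0"
      using y lt' by force
    have "integral {0..s} ?h \<noteq> 0"
    proof
      assume "integral {0..s} ?h = 0"
      then have "(?h has_integral 0) (cbox 0 s)"
        using integrable_integral[OF integrable_continuous_real[OF c]] by simp
      then have "?h y = 0"
        by (rule has_integral_0_cbox_imp_0[rotated 2]) (use c h0 y s ce in auto)
      with \<open>?h y \<noteq> 0\<close> show False by contradiction
    qed
    moreover have "0 \<le> integral {0..s} ?h"
      using h0 by (intro integral_nonneg integrable_continuous_real c)
    moreover have "integral {0..s} ?h = integral {0..s} (\<lambda>t. p t * v t) - integral {0..s} (\<lambda>t. p t * u t)"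
      using s by (subst integral_diff[symmetric]) (auto intro!: int_pu uc vc simp: right_diff_distrib)
    ultimately show ?thesis
      unfolding slope_def by (intro real_root_less_mono[OF N_pos]) simp
  qed
  then show ?thesis
    using ce by (intro exI[of _ e]) auto
qed

text \<open>A Hopf-type boundary estimate: both sides vanish at \<open>r = 1\<close>, yet the gap is
  at least linear in \<open>1 - r\<close> there, because the slopes differ by a positive minimum on
  an interval ending at 1.\<close>

lemma J_strict:
  assumes u: "nonneg_cont u" and v: "nonneg_cont v" and le: "\<And>t. t \<in> {0..1} \<Longrightarrow> u t \<le> v t"
    and x: "x \<in> {0..1}" "u x < v x"
  shows "\<exists>e>0. \<forall>r\<in>{0..1}. J u r + e * (1 - r) \<le> J v r"
proof -
  note uc = nonneg_cont_D(1)[OF u] and vc = nonneg_cont_D(1)[OF v]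
  obtain s0 where s0: "0 \<le> s0" "s0 < 1" and lt: "\<And>s. s \<in> {s0..1} \<Longrightarrow> slope u s < slope v s"
    using slope_strict[OF u v le x] by blast
  define h where "h = (\<lambda>s. slope v s - slope u s)"
  have hc: "continuous_on {0..1} h"
    unfolding h_def by (intro continuous_intros slope_cont uc vc)
  have h0: "0 \<le> h s" if "s \<in> {0..1}" for s
    unfolding h_def using slope_mono[OF uc vc le that] by simp
  have hi: "h integrable_on {r..s}" if "0 \<le> r" "s \<le> 1" for r s
    using that by (intro integrable_continuous_real continuous_on_subset[OF hc]) auto
  have "{s0..1} \<noteq> {}" "continuous_on {s0..1} h"
    using s0 hc by (auto intro: continuous_on_subset)
  then obtain s1 where s1: "s1 \<in> {s0..1}" and min: "\<And>s. s \<in> {s0..1} \<Longrightarrow> h s1 \<le> h s"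
    using continuous_attains_inf[of "{s0..1}" h] by blast
  have d: "0 < h s1"
    using lt[OF s1] by (simp add: h_def)
  have diff: "J v r - J u r = integral {r..1} h" if "0 \<le> r" for r
    unfolding J_def h_def using that by (intro integral_diff[symmetric] slope_int uc vc) auto
  have tail: "h s1 * (1 - r) \<le> integral {r..1} h" if "r \<in> {s0..1}" for r
  proof -
    have "integral {r..1} (\<lambda>_. h s1) \<le> integral {r..1} h"
      using that s0 by (intro integral_le hi min) auto
    then show ?thesis using that by (simp add: mult.commute)
  qed
  \<comment> \<open>Beyond \<open>s0\<close> the minimal slope gap \<open>h s1\<close> integrates to
    \<open>h s1 * (1 - r)\<close>; for smaller \<open>r\<close> the part beyond \<open>s0\<close>
    alone gives \<open>h s1 * (1 - s0)\<close>. The constant covers both ranges.\<close>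
  have "J u r + h s1 * (1 - s0) * (1 - r) \<le> J v r" if r: "r \<in> {0..1}" for r
  proof (cases "s0 \<le> r")
    case True
    have "h s1 * (1 - s0) * (1 - r) \<le> h s1 * (1 - r)"
      using d s0 r by (intro mult_right_mono) (auto intro: mult_left_le)
    then show ?thesis
      using tail[of r] diff[of r] True r by simp
  next
    case False
    have "h s1 * (1 - s0) * (1 - r) \<le> h s1 * (1 - s0)"
      using d s0 r by (intro mult_left_le) auto
    also have "\<dots> \<le> integral {s0..1} h"
      using tail[of s0] s0 by simp
    also have "\<dots> \<le> integral {r..1} h"
      using False r s0 by (intro integral_subset_le hi) (auto intro: h0)
    finally show ?thesis
      using diff[of r] r by simp
  qed
  then show ?thesis
    using d s0 by (intro exI[of _ "h s1 * (1 - s0)"]) auto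
qed

lemma J_0_pos:
  assumes v: "nonneg_cont v" and x: "x \<in> {0..1}" "v x \<noteq> 0"
  shows "0 < J v 0"
proof -
  have z: "nonneg_cont (\<lambda>_. 0)"
    by (simp add: nonneg_cont_def)
  have "0 < v x"
    using nonneg_cont_D(2)[OF v x(1)] x(2) by simp
  then obtain e where "e > 0" "J (\<lambda>_. 0) 0 + e \<le> J v 0"
    using J_strict[OF z v _ x(1)] nonneg_cont_D(2)[OF v] by force
  then show ?thesis
    using J_nonneg[OF z, of 0] by simp
qed

section \<open>Hoelder dependence of the operator on its argument\<close>

definition mass :: real where "mass = integral {0..1} p"

lemma mass_nonneg: "0 \<le> mass"
  unfolding mass_def using p_cont p_nonneg by (intro integral_nonneg integrable_continuous_real)

lemma root_add_le:
  assumes "0 \<le> x" "0 \<le> y"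
  shows "root N (x + y) \<le> root N x + root N y"
proof -
  have "x + y = root N x ^ N + root N y ^ N"
    using assms N_pos by simp
  also have "\<dots> \<le> (root N x + root N y) ^ N"
    using assms N by (intro add_power_le) auto
  finally have "root N (x + y) \<le> root N ((root N x + root N y) ^ N)"
    using N_pos by simp
  also have "\<dots> = root N x + root N y"
    using N_pos assms by (intro real_root_power_cancel) auto
  finally show ?thesis .
qed

text \<open>For \<open>N\<close> at least 2 the root is not Lipschitz at 0, so only an estimate with
  exponent \<open>1 / N\<close> is available: the perturbation adds at most \<open>mass * e\<close>
  under the root, and subadditivity takes it out.\<close>

lemma slope_holder:
  assumes u: "nonneg_cont u" and v: "nonneg_cont v" and e: "0 \<le> e"
    and near: "\<And>t. t \<in> {0..1} \<Longrightarrow> u t \<le> v t + e" and r: "r \<in> {0..1}"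
  shows "slope u r \<le> slope v r + root N (mass * e)"
proof -
  note uc = nonneg_cont_D(1)[OF u] and vc = nonneg_cont_D(1)[OF v]
  have "integral {0..r} (\<lambda>t. p t * u t) \<le> integral {0..r} (\<lambda>t. p t * v t + p t * e)"
  proof (intro integral_le integrable_add int_pu uc vc continuous_intros)
    show "p t * u t \<le> p t * v t + p t * e" if "t \<in> {0..r}" for t
      using mult_left_mono[OF near p_nonneg, of t] that r by (simp add: distrib_left)
  qed (use r in auto)
  also have "\<dots> = integral {0..r} (\<lambda>t. p t * v t) + integral {0..r} (\<lambda>t. p t * e)"
    using r by (intro integral_add int_pu uc vc continuous_intros) auto
  also have "integral {0..r} (\<lambda>t. p t * e) \<le> integral {0..1} (\<lambda>t. p t * e)"
    using r e p_nonneg by (intro integral_subset_le int_pu continuous_intros) auto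
  also have "\<dots> = mass * e"
    by (simp add: mass_def)
  finally have "slope u r \<le> root N (integral {0..r} (\<lambda>t. p t * v t) + mass * e)"
    unfolding slope_def using N_pos by simp
  also have "\<dots> \<le> slope v r + root N (mass * e)"
    unfolding slope_def using primitive_nonneg[OF v r] mass_nonneg e by (intro root_add_le) auto
  finally show ?thesis .
qed

lemma J_holder1:
  assumes u: "nonneg_cont u" and v: "nonneg_cont v" and e: "0 \<le> e"
    and near: "\<And>t. t \<in> {0..1} \<Longrightarrow> u t \<le> v t + e" and r: "r \<in> {0..1}"
  shows "J u r \<le> J v r + root N (mass * e)"
proof -
  note uc = nonneg_cont_D(1)[OF u] and vc = nonneg_cont_D(1)[OF v]
  have "J u r \<le> integral {r..1} (\<lambda>s. slope v s + root N (mass * e))"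
    unfolding J_def using r
    by (intro integral_le integrable_add slope_int uc vc slope_holder[OF u v e near]) auto
  also have "\<dots> = J v r + (1 - r) * root N (mass * e)"
    unfolding J_def using r by (subst integral_add) (auto intro!: slope_int vc)
  also have "(1 - r) * root N (mass * e) \<le> root N (mass * e)"
    using r e mass_nonneg by (intro mult_left_le_one_le real_root_ge_zero) auto
  finally show ?thesis by simp
qed

lemma J_holder:
  assumes u: "nonneg_cont u" and v: "nonneg_cont v" and e: "0 \<le> e"
    and near: "\<And>t. t \<in> {0..1} \<Longrightarrow> \<bar>u t - v t\<bar> \<le> e" and r: "r \<in> {0..1}"
  shows "\<bar>J u r - J v r\<bar> \<le> root N (mass * e)"
proof -
  have "u t \<le> v t + e" "v t \<le> u t + e" if "t \<in> {0..1}" for t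
    using near[OF that] by auto
  then show ?thesis
    using J_holder1[OF u v e _ r] J_holder1[OF v u e _ r] by (simp add: abs_le_iff)
qed

text \<open>A subsolution \<open>u\<close> with parameter \<open>\<mu>\<close> below the parameter
  \<open>\<kappa>\<close> of a positive supersolution \<open>v\<close> would improve any bound
  \<open>u \<le> b * v\<close> by the factor \<open>\<mu> / \<kappa>\<close>, by homogeneity and
  monotonicity. Iterating forces \<open>u\<close> to vanish.\<close>

lemma eigenvalue_comparison:
  assumes u: "nonneg_cont u" and v: "nonneg_cont v" and x: "x \<in> {0..1}" "u x \<noteq> 0"
    and v_low: "\<And>r. r \<in> {0..1} \<Longrightarrow> 1 - r \<le> v r"
    and sub: "\<And>r. r \<in> {0..1} \<Longrightarrow> u r \<le> \<mu> * J (\<lambda>t. u t ^ N) r"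
    and super: "\<And>r. r \<in> {0..1} \<Longrightarrow> \<kappa> * J (\<lambda>t. v t ^ N) r \<le> v r"
    and "0 < \<kappa>" "0 \<le> \<mu>"
  shows "\<kappa> \<le> \<mu>"
proof (rule ccontr)
  assume "\<not> \<kappa> \<le> \<mu>"
  define q where "q = \<mu> / \<kappa>"
  have q: "0 \<le> q" "q < 1" "\<mu> = q * \<kappa>"
    using \<open>0 < \<kappa>\<close> \<open>0 \<le> \<mu>\<close> \<open>\<not> \<kappa> \<le> \<mu>\<close> by (auto simp: q_def)
  note uN = nonneg_cont_power[OF u, of N] and vN = nonneg_cont_power[OF v, of N]
  \<comment> \<open>The iteration can start with this \<open>c\<close>: a subsolution is at most
    \<open>c * (1 - r)\<close>, and \<open>v_low\<close> bounds \<open>1 - r\<close> by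
    \<open>v r\<close>.\<close>
  define c where "c = \<mu> * slope (\<lambda>t. u t ^ N) 1"
  have c: "0 \<le> c"
    unfolding c_def using \<open>0 \<le> \<mu>\<close> slope_nonneg[OF uN, of 1] by simp
  have bound: "u r \<le> c * q ^ n * v r" if "r \<in> {0..1}" for r n
    using that
  proof (induction n arbitrary: r)
    case 0
    have "u r \<le> \<mu> * (slope (\<lambda>t. u t ^ N) 1 * (1 - r))"
      using sub[OF 0] J_upper[OF uN 0] \<open>0 \<le> \<mu>\<close> by (meson mult_left_mono order.trans)
    also have "\<dots> \<le> c * v r"
      using mult_left_mono[OF v_low[OF 0] c] by (simp add: c_def mult.assoc)
    finally show ?case by simp
  next
    case (Suc n)
    define b where "b = c * q ^ n"
    have b: "0 \<le> b" using c q by (simp add: b_def)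
    have "J (\<lambda>t. u t ^ N) r \<le> J (\<lambda>t. b ^ N * v t ^ N) r"
    proof (rule J_mono)
      show "u t ^ N \<le> b ^ N * v t ^ N" if "t \<in> {0..1}" for t
        using power_mono[OF Suc.IH[OF that] nonneg_cont_D(2)[OF u that], of N]
        by (simp add: b_def power_mult_distrib)
    qed (use uN vN Suc.prems in \<open>auto intro: continuous_intros nonneg_cont_D(1)\<close>)
    also have "\<dots> = b * J (\<lambda>t. v t ^ N) r"
      using b by (rule J_cmult)
    finally have "\<mu> * J (\<lambda>t. u t ^ N) r \<le> \<mu> * (b * J (\<lambda>t. v t ^ N) r)"
      using \<open>0 \<le> \<mu>\<close> by (rule mult_left_mono)
    also have "\<dots> = b * q * (\<kappa> * J (\<lambda>t. v t ^ N) r)"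
      by (simp add: q(3))
    also have "\<dots> \<le> b * q * v r"
      using super[OF Suc.prems] b q by (intro mult_left_mono) auto
    finally show ?case
      using sub[OF Suc.prems] by (simp add: b_def mult_ac)
  qed
  have "(\<lambda>n. c * q ^ n * v x) \<longlonglongrightarrow> c * 0 * v x"
    using q by (intro tendsto_intros LIMSEQ_power_zero) auto
  then have "u x \<le> 0"
    using bound[OF x(1)] by (intro LIMSEQ_le_const) auto
  then show False
    using nonneg_cont_D(2)[OF u x(1)] x(2) by simp
qed

text \<open>The least \<^term>\<open>c\<close> with \<^prop>\<open>v \<le> c * w\<close> could be lowered if the two sides differed
  anywhere, because the operator turns a difference into a gap of order \<^term>\<open>1 - r\<close>.\<close>

lemma positive_eigenfunction_unique:
  assumes v: "v \<in> profiles" and w: "w \<in> profiles" and "0 < \<kappa>"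
    and ev: "\<And>r. r \<in> {0..1} \<Longrightarrow> val v r = \<kappa> * J (\<lambda>t. val v t ^ N) r"
    and ew: "\<And>r. r \<in> {0..1} \<Longrightarrow> val w r = \<kappa> * J (\<lambda>t. val w t ^ N) r"
  shows "v = w"
proof -
  have nc: "nonneg_cont (val v)" "nonneg_cont (val w)"
    using profilesD(3)[OF v] profilesD(3)[OF w] by (auto simp: nonneg_cont_def intro: continuous_on_val)
  note vN = nonneg_cont_power[OF nc(1), of N] and wN = nonneg_cont_power[OF nc(2), of N]
  have upper: "\<exists>b>0. \<forall>r\<in>{0..1}. val x r \<le> b * (1 - r)"
    if nx: "nonneg_cont (\<lambda>t. val x t ^ N)" and ex: "\<And>r. r \<in> {0..1} \<Longrightarrow> val x r = \<kappa> * J (\<lambda>t. val x t ^ N) r" for x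
  proof -
    let ?b = "\<kappa> * slope (\<lambda>t. val x t ^ N) 1"
    have b: "0 \<le> ?b"
      using \<open>0 < \<kappa>\<close> slope_nonneg[OF nx, of 1] by simp
    have "val x r \<le> (?b + 1) * (1 - r)" if r: "r \<in> {0..1}" for r
    proof -
      have "val x r \<le> \<kappa> * (slope (\<lambda>t. val x t ^ N) 1 * (1 - r))"
        using ex[OF r] J_upper[OF nx r] \<open>0 < \<kappa>\<close> by simp
      also have "\<dots> \<le> (?b + 1) * (1 - r)"
        using r by (simp add: algebra_simps)
      finally show ?thesis .
    qed
    then show ?thesis
      using b by (intro exI[of _ "?b + 1"]) auto
  qed
  obtain bv where bv: "0 < bv" "\<And>r. r \<in> {0..1} \<Longrightarrow> val v r \<le> bv * (1 - r)"
    using upper[OF vN ev] by blast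
  obtain bw where bw: "0 < bw" "\<And>r. r \<in> {0..1} \<Longrightarrow> val w r \<le> bw * (1 - r)"
    using upper[OF wN ew] by blast
  define A where "A = {c. \<forall>r\<in>{0..1}. val v r \<le> c * val w r}"
  have bvA: "bv \<in> A"
    unfolding A_def
  proof (intro CollectI ballI)
    fix r :: real assume r: "r \<in> {0..1}"
    show "val v r \<le> bv * val w r"
      using bv(1) by (intro order.trans[OF bv(2)[OF r]] mult_left_mono profilesD(1)[OF w r]) auto
  qed
  have A1: "1 \<le> c" if "c \<in> A" for c
    using that profile_at_0[OF v] profile_at_0[OF w] by (force simp: A_def)
  then have bdd: "bdd_below A"
    by (rule bdd_belowI)
  have "closed A"
  proof -
    have "A = (\<Inter>r\<in>{0..1}. {c. val v r \<le> c * val w r})"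
      by (auto simp: A_def)
    also have "closed \<dots>"
      by (intro closed_INT ballI closed_Collect_le continuous_intros)
    finally show ?thesis .
  qed
  then have cA: "Inf A \<in> A"
    using bvA bdd by (intro closed_contains_Inf) auto
  define c where "c = Inf A"
  have c1: "1 \<le> c"
    using A1 cA by (simp add: c_def)
  have le: "val v r \<le> c * val w r" if "r \<in> {0..1}" for r
    using cA that by (simp add: c_def A_def)
  have cwN: "nonneg_cont (\<lambda>t. c ^ N * val w t ^ N)"
    using c1 by (intro nonneg_cont_cmult wN) auto
  have eq: "val v x = c * val w x" if x: "x \<in> {0..1}" for x
  proof (rule ccontr)
    assume "val v x \<noteq> c * val w x"
    then have "val v x < c * val w x"
      using le[OF x] by simp
    then have lt: "val v x ^ N < c ^ N * val w x ^ N"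
      using N_pos nonneg_cont_D(2)[OF nc(1) x] by (simp add: power_strict_mono flip: power_mult_distrib)
    have leN: "val v t ^ N \<le> c ^ N * val w t ^ N" if "t \<in> {0..1}" for t
      using power_mono[OF le[OF that] nonneg_cont_D(2)[OF nc(1) that], of N] by (simp add: power_mult_distrib)
    obtain e where e: "0 < e"
      and gap: "\<And>r. r \<in> {0..1} \<Longrightarrow> J (\<lambda>t. val v t ^ N) r + e * (1 - r) \<le> J (\<lambda>t. c ^ N * val w t ^ N) r"
      using J_strict[OF vN cwN leN x lt] by blast
    \<comment> \<open>Since \<open>w\<close> is at most \<open>bw * (1 - r)\<close>, lowering
      \<open>c\<close> by \<open>\<kappa> * e / bw\<close> costs at most
      \<open>\<kappa> * e * (1 - r)\<close>, which is the available gap.\<close>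
    have "c - \<kappa> * e / bw \<in> A"
      unfolding A_def
    proof (intro CollectI ballI)
      fix r :: real assume r: "r \<in> {0..1}"
      have "\<kappa> * (J (\<lambda>t. val v t ^ N) r + e * (1 - r)) \<le> \<kappa> * (c * J (\<lambda>t. val w t ^ N) r)"
        using gap[OF r] J_cmult[of c "\<lambda>t. val w t ^ N" r] c1 \<open>0 < \<kappa>\<close> by (intro mult_left_mono) auto
      then have "val v r + \<kappa> * e * (1 - r) \<le> c * val w r"
        using ev[OF r] ew[OF r] by (simp add: algebra_simps)
      moreover have "\<kappa> * e / bw * val w r \<le> \<kappa> * e / bw * (bw * (1 - r))"
        using bw(1) bw(2)[OF r] \<open>0 < \<kappa>\<close> e by (intro mult_left_mono) auto
      moreover have "\<kappa> * e / bw * (bw * (1 - r)) = \<kappa> * e * (1 - r)"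
        using bw(1) by simp
      ultimately show "val v r \<le> (c - \<kappa> * e / bw) * val w r"
        by (simp add: left_diff_distrib)
    qed
    then have "c \<le> c - \<kappa> * e / bw"
      unfolding c_def using bdd by (intro cInf_lower)
    then show False
      using e bw(1) \<open>0 < \<kappa>\<close> by (simp add: divide_le_0_iff mult_le_0_iff)
  qed
  have "c = 1"
    using eq[of 0] profile_at_0[OF v] profile_at_0[OF w] by simp
  then show ?thesis
    using eq by (intro C01_eqI) simp
qed

end

section \<open>The rescaled fixed point problem\<close>

locale nonlinear = weight +
  fixes \<rho> :: "real \<Rightarrow> real"
  assumes \<rho>_cont: "continuous_on {0..} \<rho>" and \<rho>_nonneg: "\<And>s. 0 \<le> s \<Longrightarrow> 0 \<le> \<rho> s" and \<rho>_0: "\<rho> 0 = 0"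
begin

text \<open>At \<open>q = (s, w)\<close> with positive \<open>s\<close> this is the reaction term of
  \<open>s w\<close> divided by \<open>s ^ N\<close>; the form written here still makes sense at
  \<open>s = 0\<close>.\<close>

definition source :: "real \<times> C01 \<Rightarrow> real \<Rightarrow> real" where
  "source q t = val (snd q) t ^ N * (1 + \<rho> (fst q * val (snd q) t))"

definition strip :: "(real \<times> C01) set" where
  "strip = {0..} \<times> profiles"

definition height :: "real \<times> C01 \<Rightarrow> real" where
  "height q = J (source q) 0"

definition F :: "real \<times> C01 \<Rightarrow> C01" where
  "F q = (1 / height q) *\<^sub>R C01_of (J (source q))"

definition fixed_points :: "(real \<times> C01) set" where
  "fixed_points = {q \<in> strip. F q = snd q}"

text \<open>A profile has value 1 at 0, so evaluating \<open>w = \<lambda> J (source (s, w))\<close>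
  at 0 leaves \<open>1 / height\<close> as the only possible parameter.\<close>

definition param :: "real \<times> C01 \<Rightarrow> real \<times> C01" where
  "param q = (1 / height q, fst q *\<^sub>R snd q)"

section \<open>Continuity and uniform bounds for the normalized map\<close>

lemma stripD: "q \<in> strip \<Longrightarrow> 0 \<le> fst q" "q \<in> strip \<Longrightarrow> snd q \<in> profiles"
  by (auto simp: strip_def)

lemma closed_strip: "closed strip"
  unfolding strip_def by (intro closed_Times closed_profiles closed_atLeast)

lemma source_nc:
  assumes "q \<in> strip"
  shows "nonneg_cont (source q)"
  unfolding nonneg_cont_def
proof
  note w = profilesD[OF stripD(2)[OF assms]] and s = stripD(1)[OF assms]
  show "continuous_on {0..1} (source q)"
    unfolding source_def
    by (intro continuous_intros continuous_on_compose2[OF \<rho>_cont] continuous_on_val) (use w s in auto)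
  show "\<forall>r\<in>{0..1}. 0 \<le> source q r"
    unfolding source_def using w s \<rho>_nonneg by simp
qed

lemma source_lower: "q \<in> strip \<Longrightarrow> t \<in> {0..1} \<Longrightarrow> (1 - t) ^ N \<le> source q t"
proof -
  assume q: "q \<in> strip" and t: "t \<in> {0..1}"
  note w = profilesD[OF stripD(2)[OF q] t]
  have "(1 - t) ^ N \<le> val (snd q) t ^ N"
    using w t by (intro power_mono) auto
  also have "\<dots> \<le> source q t"
    unfolding source_def using w(3) stripD(1)[OF q] \<rho>_nonneg by (simp add: mult_le_cancel_left1)
  finally show ?thesis .
qed

text \<open>The height produced by the smallest profile \<open>1 - r\<close> with
  \<open>\<rho>\<close> dropped. It bounds all heights on the strip from below, whatever the
  amplitude.\<close>

definition height_min :: real where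
  "height_min = J (\<lambda>t. (1 - t) ^ N) 0"

lemma chord_nc: "nonneg_cont (\<lambda>t. (1 - t) ^ N)"
proof -
  have "continuous_on {0..1} (\<lambda>t::real. (1 - t) ^ N)"
    by (intro continuous_intros)
  then show ?thesis by (simp add: nonneg_cont_def)
qed

lemma height_min_pos: "0 < height_min"
  unfolding height_min_def by (rule J_0_pos[OF chord_nc, of 0]) auto

lemma height_ge:
  assumes "q \<in> strip"
  shows "height_min \<le> height q"
  unfolding height_min_def height_def
  by (intro J_mono nonneg_cont_D(1)[OF source_nc] nonneg_cont_D(1)[OF chord_nc] source_lower assms) auto

lemma height_pos: "q \<in> strip \<Longrightarrow> 0 < height q"
  using height_ge height_min_pos by fastforce

lemma height_nz: "q \<in> strip \<Longrightarrow> height q \<noteq> 0"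
  using height_pos[of q] by simp

lemma val_J: "q \<in> strip \<Longrightarrow> r \<in> {0..1} \<Longrightarrow> val (C01_of (J (source q))) r = J (source q) r"
  by (intro val_C01_of J_cont nonneg_cont_D(1)[OF source_nc])

lemma val_F: "q \<in> strip \<Longrightarrow> r \<in> {0..1} \<Longrightarrow> val (F q) r = J (source q) r / height q"
  by (simp add: F_def val_J)

lemma height_eq_val: "q \<in> strip \<Longrightarrow> height q = val (C01_of (J (source q))) 0"
  by (simp add: height_def val_J)

text \<open>Uniform continuity on a compact rectangle converts sup-norm closeness of profiles into
  closeness of their sources at all points at once.\<close>

lemma kernel_uniform:
  assumes "0 \<le> R" "0 < e"
  shows "\<exists>d>0. \<forall>s\<in>{0..R}. \<forall>s'\<in>{0..R}. \<forall>x\<in>{0..1}. \<forall>x'\<in>{0..1}.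
    dist (s', x') (s, x) < d \<longrightarrow> \<bar>x' ^ N * (1 + \<rho> (s' * x')) - x ^ N * (1 + \<rho> (s * x))\<bar> < e"
proof -
  have "continuous_on ({0..R} \<times> {0..1}) (\<lambda>z. snd z ^ N * (1 + \<rho> (fst z * snd z)))"
    by (intro continuous_intros continuous_on_compose2[OF \<rho>_cont]) auto
  then have "uniformly_continuous_on ({0..R} \<times> {0..1}) (\<lambda>z. snd z ^ N * (1 + \<rho> (fst z * snd z)))"
    by (intro compact_uniformly_continuous compact_Times) auto
  then obtain d where "0 < d" and "\<forall>z\<in>{0..R} \<times> {0..1}. \<forall>z'\<in>{0..R} \<times> {0..1}. dist z' z < d \<longrightarrow>
    dist (snd z' ^ N * (1 + \<rho> (fst z' * snd z'))) (snd z ^ N * (1 + \<rho> (fst z * snd z))) < e"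
    using \<open>0 < e\<close> unfolding uniformly_continuous_on_def by meson
  then show ?thesis
    by (intro exI[of _ d]) (auto simp: dist_real_def Ball_def)
qed

lemma J_source_cont: "continuous_on strip (\<lambda>q. C01_of (J (source q)))"
  unfolding continuous_on_iff
proof (intro ballI allI impI)
  fix q :: "real \<times> C01" and e :: real
  assume q: "q \<in> strip" and e: "0 < e"
  \<comment> \<open>Chosen so that the Hoelder bound \<open>root N (mass * e')\<close> is at most
    \<open>e / 2\<close>; \<open>mass + 1\<close> keeps the quotient meaningful.\<close>
  define e' where "e' = (e / 2) ^ N / (mass + 1)"
  have e': "0 < e'" "mass * e' \<le> (e / 2) ^ N"
  proof -
    show "0 < e'"
      unfolding e'_def using e mass_nonneg by (intro divide_pos_pos zero_less_power) auto
    have "mass / (mass + 1) * (e / 2) ^ N \<le> 1 * (e / 2) ^ N"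
      using e mass_nonneg by (intro mult_right_mono) auto
    then show "mass * e' \<le> (e / 2) ^ N"
      by (simp add: e'_def)
  qed
  define R where "R = fst q + 1"
  have R: "0 \<le> R" using stripD(1)[OF q] by (simp add: R_def)
  obtain d where d: "0 < d" and near: "\<And>s s' x x'. \<lbrakk>s \<in> {0..R}; s' \<in> {0..R}; x \<in> {0..1}; x' \<in> {0..1};
    dist (s', x') (s, x) < d\<rbrakk> \<Longrightarrow> \<bar>x' ^ N * (1 + \<rho> (s' * x')) - x ^ N * (1 + \<rho> (s * x))\<bar> < e'"
    using kernel_uniform[OF R e'(1)] by blast
  show "\<exists>d>0. \<forall>q'\<in>strip. dist q' q < d \<longrightarrow> dist (C01_of (J (source q'))) (C01_of (J (source q))) < e"
  proof (intro exI conjI ballI impI)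
    show "0 < min d 1" using d by simp
    fix q' assume q': "q' \<in> strip" "dist q' q < min d 1"
    have "dist (fst q') (fst q) < 1"
      using q'(2) dist_fst_le[of q' q] by simp
    then have s: "fst q \<in> {0..R}" "fst q' \<in> {0..R}"
      using stripD(1)[OF q] stripD(1)[OF q'(1)] by (auto simp: R_def dist_real_def)
    have src: "\<bar>source q' t - source q t\<bar> \<le> e'" if t: "t \<in> {0..1}" for t
    proof -
      have "\<bar>val (snd q') t - val (snd q) t\<bar> \<le> dist (snd q') (snd q)"
        using abs_val_le_norm[of "snd q' - snd q" t] by (simp add: dist_norm)
      then have "(val (snd q') t - val (snd q) t)\<^sup>2 \<le> (dist (snd q') (snd q))\<^sup>2"
        using power_mono[of "\<bar>val (snd q') t - val (snd q) t\<bar>" _ 2] by simp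
      then have "dist (fst q', val (snd q') t) (fst q, val (snd q) t) \<le> dist q' q"
        unfolding dist_prod_def by (simp add: dist_real_def)
      then show ?thesis
        unfolding source_def
        using profilesD[OF stripD(2)[OF q] t] profilesD[OF stripD(2)[OF q'(1)] t] q'(2)
        by (intro less_imp_le near s) auto
    qed
    have "\<bar>J (source q') r - J (source q) r\<bar> \<le> e / 2" if r: "r \<in> {0..1}" for r
    proof -
      have "\<bar>J (source q') r - J (source q) r\<bar> \<le> root N (mass * e')"
        using e'(1) by (intro J_holder source_nc q q'(1) src r) auto
      also have "\<dots> \<le> root N ((e / 2) ^ N)"
        using e'(2) N_pos by simp
      also have "\<dots> = e / 2"
        using e N_pos by (intro real_root_power_cancel) auto
      finally show ?thesis .
    qed
    then have "norm (C01_of (J (source q')) - C01_of (J (source q))) \<le> e / 2"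
      using q q'(1) by (intro norm_C01_le) (simp add: val_J)
    then show "dist (C01_of (J (source q'))) (C01_of (J (source q))) < e"
      using e by (simp add: dist_norm)
  qed
qed

lemma height_cont: "continuous_on strip height"
proof -
  have "continuous_on strip (\<lambda>q. val (C01_of (J (source q))) 0)"
    by (rule continuous_on_compose2[OF continuous_val[of UNIV] J_source_cont]) auto
  then show ?thesis
    by (rule continuous_on_eq) (simp add: height_eq_val)
qed

lemma F_cont: "continuous_on strip F"
  unfolding F_def
  by (intro continuous_intros height_cont J_source_cont) (simp add: height_nz)

lemma param_cont: "continuous_on strip param"
  unfolding param_def
  by (intro continuous_intros height_cont) (simp add: height_nz)

lemma closed_fixed_points: "closed fixed_points"
proof -
  have "closed {q \<in> strip. F q - snd q = 0}"
    by (intro continuous_closed_preimage_constant closed_strip continuous_intros F_cont)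
  then show ?thesis by (simp add: fixed_points_def)
qed

lemma F_profiles:
  assumes q: "q \<in> strip"
  shows "F q \<in> profiles"
  unfolding profiles_def
proof (intro CollectI ballI)
  fix r :: real assume r: "r \<in> {0..1}"
  have "J (source q) r \<le> height q"
    unfolding height_def using r by (intro J_lip1(1) source_nc q) auto
  moreover have "(1 - r) * height q \<le> J (source q) r"
    unfolding height_def by (intro J_chord source_nc q r)
  ultimately show "val (F q) r \<in> {1 - r..1}"
    using height_pos[OF q] r q by (simp add: val_F field_simps)
qed

text \<open>For amplitudes up to \<open>R\<close> the arguments of \<open>\<rho>\<close> stay in a
  compact interval, so sources and hence slopes are bounded; dividing by \<open>height_min\<close>
  gives \<open>M\<close>, which depends on \<open>R\<close>.\<close>

lemma F_lip_profiles:
  assumes "0 \<le> R"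
  shows "\<exists>M. \<forall>q\<in>{0..R} \<times> profiles. F q \<in> lip_profiles M"
proof -
  have "bounded (\<rho> ` {0..R})"
    by (intro compact_imp_bounded compact_continuous_image continuous_on_subset[OF \<rho>_cont]) auto
  then obtain B where "\<forall>y\<in>\<rho> ` {0..R}. norm y \<le> B"
    unfolding bounded_iff by blast
  then have B: "\<rho> s \<le> B" if "s \<in> {0..R}" for s
    using that by (metis abs_le_D1 imageI real_norm_def)
  define M where "M = slope (\<lambda>_. 1 + B) 1 / height_min"
  have "F q \<in> lip_profiles M" if "q \<in> {0..R} \<times> profiles" for q
  proof -
    have q: "q \<in> strip" and s: "fst q \<in> {0..R}"
      using that by (auto simp: strip_def)
    have "source q t \<le> 1 + B" if t: "t \<in> {0..1}" for t
    proof -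
      note w = profilesD[OF stripD(2)[OF q] t]
      have "fst q * val (snd q) t \<in> {0..R}"
        using w s mult_mono[of "fst q" R "val (snd q) t" 1] by auto
      then have "\<rho> (fst q * val (snd q) t) \<le> B" "0 \<le> \<rho> (fst q * val (snd q) t)"
        using B \<rho>_nonneg by auto
      moreover have "0 \<le> val (snd q) t ^ N" "val (snd q) t ^ N \<le> 1"
        using w by (auto intro: power_le_one)
      ultimately show ?thesis
        unfolding source_def using mult_mono[of "val (snd q) t ^ N" 1 "1 + \<rho> (fst q * val (snd q) t)" "1 + B"] by simp
    qed
    then have sl: "slope (source q) 1 \<le> slope (\<lambda>_. 1 + B) 1"
      by (intro slope_mono nonneg_cont_D(1)[OF source_nc] q) auto
    have "slope (source q) 1 / height q \<le> M"
      unfolding M_def using slope_nonneg[OF source_nc[OF q], of 1] height_ge[OF q] height_min_pos sl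
      by (intro frac_le) auto
    have "\<bar>val (F q) r - val (F q) t\<bar> \<le> M * \<bar>r - t\<bar>" if rt: "r \<in> {0..1}" "t \<in> {0..1}" for r t
    proof -
      have "\<bar>val (F q) r - val (F q) t\<bar> = \<bar>J (source q) r - J (source q) t\<bar> / height q"
        using rt q height_pos[OF q] by (simp add: val_F flip: diff_divide_distrib)
      also have "\<dots> \<le> slope (source q) 1 * \<bar>r - t\<bar> / height q"
        using J_lip[OF source_nc[OF q] rt] height_pos[OF q] by (intro divide_right_mono) auto
      also have "\<dots> = slope (source q) 1 / height q * \<bar>r - t\<bar>"
        by simp
      also have "\<dots> \<le> M * \<bar>r - t\<bar>"
        by (intro mult_right_mono) (fact, simp)
      finally show ?thesis .
    qed
    then show ?thesis
      using F_profiles[OF q] by (simp add: lip_profiles_def)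
  qed
  then show ?thesis by blast
qed

section \<open>Compactness and connectedness properties of the fixed point set\<close>

lemma profiles_nonempty: "C01_of (\<lambda>r. 1 - r) \<in> profiles"
proof -
  have "continuous_on {0..1} (\<lambda>r::real. 1 - r)"
    by (intro continuous_intros)
  then show ?thesis
    by (auto simp: profiles_def val_C01_of)
qed

lemma fixed_points_continuum:
  assumes "0 \<le> R"
  shows "\<exists>C. connected C \<and> C \<subseteq> fixed_points \<and> (\<exists>w. (0, w) \<in> C) \<and> (\<exists>w. (R, w) \<in> C)"
proof -
  obtain M where M: "\<And>q. q \<in> {0..R} \<times> profiles \<Longrightarrow> F q \<in> lip_profiles M"
    using F_lip_profiles[OF assms] by blast
  have sub: "lip_profiles M \<subseteq> profiles"
    by (auto simp: lip_profiles_def)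
  then have subd: "{0..R} \<times> lip_profiles M \<subseteq> strip"
    by (auto simp: strip_def)
  have "\<exists>C. connected C \<and> C \<subseteq> {p \<in> {0..R} \<times> lip_profiles M. F p = snd p} \<and> (\<exists>w. (0, w) \<in> C) \<and> (\<exists>w. (R, w) \<in> C)"
  proof (rule browder_continuum)
    show "lip_profiles M \<noteq> {}"
      using M[of "(0, C01_of (\<lambda>r. 1 - r))"] profiles_nonempty assms by auto
    show "F ` ({0..R} \<times> lip_profiles M) \<subseteq> lip_profiles M"
      using M sub by blast
  qed (use assms compact_lip_profiles convex_lip_profiles continuous_on_subset[OF F_cont subd] in auto)
  moreover have "{p \<in> {0..R} \<times> lip_profiles M. F p = snd p} \<subseteq> fixed_points"
    using subd by (auto simp: fixed_points_def)
  ultimately show ?thesis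
    by (meson order.trans)
qed

text \<open>A fixed point is its own image under \<open>F\<close> and so inherits the Lipschitz
  bound; bounding the amplitudes alone gives compactness.\<close>

lemma fixed_points_seq_compact:
  fixes R :: real and q :: "nat \<Rightarrow> real \<times> C01"
  assumes q: "\<And>n. q n \<in> fixed_points" and bd: "\<And>n. fst (q n) \<le> R"
  shows "\<exists>l\<in>fixed_points. \<exists>k. strict_mono k \<and> (q \<circ> k) \<longlonglongrightarrow> l"
proof -
  have R: "0 \<le> R"
    using bd[of 0] q[of 0] stripD(1)[of "q 0"] by (simp add: fixed_points_def)
  obtain M where M: "\<And>q. q \<in> {0..R} \<times> profiles \<Longrightarrow> F q \<in> lip_profiles M"
    using F_lip_profiles[OF R] by blast
  have "q n \<in> {0..R} \<times> profiles" for n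
    using q[of n] bd[of n] by (auto simp: fixed_points_def strip_def mem_Times_iff)
  then have "q n \<in> {0..R} \<times> lip_profiles M" for n
    using M[of "q n"] q[of n] by (auto simp: fixed_points_def mem_Times_iff)
  moreover have "compact ({0..R} \<times> lip_profiles M)"
    by (intro compact_Times compact_lip_profiles compact_Icc)
  ultimately obtain l k where k: "strict_mono k" "(q \<circ> k) \<longlonglongrightarrow> l"
    unfolding compact_def by meson
  moreover have "l \<in> fixed_points"
    using closed_sequentially[OF closed_fixed_points _ k(2)] q by simp
  ultimately show ?thesis by blast
qed

lemma norm_snd_param:
  assumes "q \<in> strip"
  shows "norm (snd (param q)) = fst q"
  using norm_profile[OF stripD(2)[OF assms]] stripD(1)[OF assms] by (simp add: param_def)

text \<open>Amplitudes are norms of the second components of the images, so convergent images have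
  bounded amplitudes and the preceding compactness applies.\<close>

lemma param_proper:
  assumes q: "\<And>n. q n \<in> fixed_points" and lim: "(\<lambda>n. param (q n)) \<longlonglongrightarrow> l"
  shows "\<exists>q'\<in>fixed_points. \<exists>k. strict_mono k \<and> (q \<circ> k) \<longlonglongrightarrow> q' \<and> param q' = l"
proof -
  have qd: "q n \<in> strip" for n using q by (simp add: fixed_points_def)
  have "(\<lambda>n. fst (q n)) \<longlonglongrightarrow> norm (snd l)"
    using tendsto_norm[OF tendsto_snd[OF lim]] by (simp add: norm_snd_param[OF qd])
  then have "Bseq (\<lambda>n. fst (q n))"
    by (rule convergent_imp_Bseq[OF convergentI])
  then obtain R where R: "\<forall>n. norm (fst (q n)) \<le> R"
    using BseqE by blast
  have bd: "fst (q n) \<le> R" for n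
    using R[rule_format, of n] by simp
  obtain q' where q': "q' \<in> fixed_points" and sub: "\<exists>k. strict_mono k \<and> (q \<circ> k) \<longlonglongrightarrow> q'"
    using fixed_points_seq_compact[OF q bd] by (rule bexE)
  from sub obtain k where k: "strict_mono k" "(q \<circ> k) \<longlonglongrightarrow> q'"
    by (elim exE conjE)
  have "(\<lambda>n. param ((q \<circ> k) n)) \<longlonglongrightarrow> param q'"
    using q' qd by (intro continuous_on_tendsto_compose[OF param_cont k(2)]) (auto simp: fixed_points_def)
  moreover have "(\<lambda>n. param ((q \<circ> k) n)) \<longlonglongrightarrow> l"
    using LIMSEQ_subseq_LIMSEQ[OF lim k(1)] by (simp add: o_def)
  ultimately have "param q' = l"
    by (rule LIMSEQ_unique)
  then show ?thesis using q' k by blast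
qed

lemma fixed_point_eq:
  assumes "q \<in> fixed_points" "r \<in> {0..1}"
  shows "val (snd q) r = 1 / height q * J (source q) r"
proof -
  have "q \<in> strip" "F q = snd q" using assms by (auto simp: fixed_points_def)
  then show ?thesis using val_F[of q r] assms(2) by simp
qed

section \<open>The eigenvalue problem at amplitude zero\<close>

lemma source_at_0: "source (0, w) = (\<lambda>t. val w t ^ N)"
  by (rule ext) (simp add: source_def \<rho>_0)

text \<open>The fixed point is the positive supersolution in the comparison. Arbitrary subsolutions
  \<open>u\<close> are allowed so that the result covers other fixed points as well as absolute
  values of sign-changing eigenfunctions.\<close>

lemma fixed_point_at_0_minimal:
  assumes q: "(0, w) \<in> fixed_points" and u: "nonneg_cont u" and x: "x \<in> {0..1}" "u x \<noteq> 0" and \<mu>: "0 \<le> \<mu>"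
    and sub: "\<And>r. r \<in> {0..1} \<Longrightarrow> u r \<le> \<mu> * J (\<lambda>t. u t ^ N) r"
  shows "1 / height (0, w) \<le> \<mu>"
proof (rule eigenvalue_comparison[OF u _ x _ sub _ _ \<mu>])
  have qd: "(0, w) \<in> strip" and w: "w \<in> profiles"
    using q by (auto simp: fixed_points_def strip_def)
  show "nonneg_cont (val w)"
    using profilesD(3)[OF w] by (auto simp: nonneg_cont_def intro: continuous_on_val)
  show "1 - r \<le> val w r" if "r \<in> {0..1}" for r
    using profilesD(1)[OF w that] .
  show "1 / height (0, w) * J (\<lambda>t. val w t ^ N) r \<le> val w r" if "r \<in> {0..1}" for r
    using fixed_point_eq[OF q that] by (simp add: source_at_0)
  show "0 < 1 / height (0, w)"
    using height_pos[OF qd] by simp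
qed

text \<open>Each fixed point acts as a subsolution against the other, so their eigenvalues agree;
  only then does uniqueness of the normalized eigenfunction for a common eigenvalue apply.\<close>

lemma fixed_point_at_0_unique:
  assumes v: "(0, v) \<in> fixed_points" and w: "(0, w) \<in> fixed_points"
  shows "v = w"
proof -
  have ev: "val x r = 1 / height (0, x) * J (\<lambda>t. val x t ^ N) r" if "(0, x) \<in> fixed_points" "r \<in> {0..1}" for x r
    using fixed_point_eq[OF that] by (simp add: source_at_0)
  have prof: "x \<in> profiles" "(0, x) \<in> strip" if "(0, x) \<in> fixed_points" for x
    using that by (auto simp: fixed_points_def strip_def)
  have le: "1 / height (0, x) \<le> 1 / height (0, y)" if x: "(0, x) \<in> fixed_points" and y: "(0, y) \<in> fixed_points" for x y
  proof (rule fixed_point_at_0_minimal[OF x, of "val y" 0])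
    show "nonneg_cont (val y)"
      using profilesD(3)[OF prof(1)[OF y]] by (auto simp: nonneg_cont_def intro: continuous_on_val)
  qed (use ev[OF y] profile_at_0[OF prof(1)[OF y]] height_pos[OF prof(2)[OF y]] in auto)
  have "1 / height (0, v) = 1 / height (0, w)"
    using le v w by (intro antisym)
  then show ?thesis
    using positive_eigenfunction_unique[OF prof(1)[OF v] prof(1)[OF w], of "1 / height (0, v)"]
      ev v w height_pos[OF prof(2)[OF v]] by simp
qed

end

section \<open>Solutions of the boundary value problem\<close>

locale radial_problem =
  fixes N :: nat and a g :: "real \<Rightarrow> real"
  assumes N1: "1 \<le> N"
    and a_cont: "continuous_on {0..1} a"
    and a_nonneg: "\<And>r. r \<in> {0..1} \<Longrightarrow> 0 \<le> a r"
    and a_nontriv: "\<And>c d. 0 \<le> c \<Longrightarrow> c < d \<Longrightarrow> d \<le> 1 \<Longrightarrow> \<exists>r\<in>{c<..<d}. a r \<noteq> 0"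
    and g_cont: "continuous_on {0..} g"
    and g_nonneg: "\<And>s. 0 \<le> s \<Longrightarrow> 0 \<le> g s"
    and g_small: "((\<lambda>s. g s / s ^ N) \<longlongrightarrow> 0) (at_right 0)"
begin

definition p :: "real \<Rightarrow> real" where
  "p t = real N * t ^ (N - 1) * a t"

definition \<rho> :: "real \<Rightarrow> real" where
  "\<rho> t = (if t = 0 then 0 else g t / t ^ N)"

lemma g_at_0: "g 0 = 0"
proof -
  have "((\<lambda>s. g s / s ^ N * s ^ N) \<longlongrightarrow> 0 * 0 ^ N) (at_right 0)"
    by (intro tendsto_intros g_small)
  then have "((\<lambda>s. g s / s ^ N * s ^ N) \<longlongrightarrow> 0) (at_right 0)"
    by simp
  then have "(g \<longlongrightarrow> 0) (at_right 0)"
    by (rule Lim_transform_eventually) (simp add: eventually_at_filter)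
  moreover have "(g \<longlongrightarrow> g 0) (at_right 0)"
    using g_cont by (auto simp: continuous_on_def intro: tendsto_within_subset)
  ultimately show ?thesis
    using tendsto_unique trivial_limit_at_right_real by blast
qed

sublocale nonlinear N p \<rho>
proof
  show "1 \<le> N" by (rule N1)
  show "continuous_on {0..1} p"
    unfolding p_def by (intro continuous_intros a_cont)
  show "0 \<le> p r" if "r \<in> {0..1}" for r
    using a_nonneg[OF that] that by (simp add: p_def)
  \<comment> \<open>Points of the open interval are positive, so the factor
    \<open>r ^ (N - 1)\<close> cannot cancel a nonzero value of \<open>a\<close>.\<close>
  show "\<exists>r\<in>{c<..<d}. p r \<noteq> 0" if cd: "0 \<le> c" "c < d" "d \<le> 1" for c d
    using a_nontriv[OF cd] N1 cd(1) by (fastforce simp: p_def)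
  show "\<rho> 0 = 0" by (simp add: \<rho>_def)
  show "0 \<le> \<rho> s" if "0 \<le> s" for s
    using g_nonneg[OF that] that by (simp add: \<rho>_def)
  show "continuous_on {0..} \<rho>"
    unfolding continuous_on_def
  proof
    fix x :: real assume "x \<in> {0..}"
    then consider "x = 0" | "0 < x" by fastforce
    then show "(\<rho> \<longlongrightarrow> \<rho> x) (at x within {0..})"
    proof cases
      case 1
      have "(\<rho> \<longlongrightarrow> 0) (at_right 0)"
        using g_small by (rule Lim_transform_eventually) (auto simp: \<rho>_def eventually_at_filter)
      moreover have "{0::real..} - {0} = {0<..} - {0}"
        by auto
      then have "at (0::real) within {0..} = at_right 0"
        by (simp only: at_within_def)
      ultimately show ?thesis using 1 by (simp add: \<rho>_def)
    next
      case 2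
      have at: "at x within {0..} = at x"
        using 2 by (intro at_within_open_subset[of _ "{0<..}"]) auto
      have "(g \<longlongrightarrow> g x) (at x within {0..})"
        using g_cont 2 by (simp add: continuous_on_def)
      then have "((\<lambda>t. g t / t ^ N) \<longlongrightarrow> g x / x ^ N) (at x)"
        unfolding at using 2 by (intro tendsto_intros) auto
      moreover have "\<forall>\<^sub>F t in at x. t \<in> {0<..} - {x}"
        using 2 by (intro eventually_at_in_open) auto
      then have "\<forall>\<^sub>F t in at x. g t / t ^ N = \<rho> t"
        by (rule eventually_mono) (simp add: \<rho>_def)
      ultimately show ?thesis
        using 2 at by (auto simp: \<rho>_def intro: Lim_transform_eventually)
    qed
  qed
qed

section \<open>Correspondence between fixed points and solutions\<close>

lemma reaction_eq: "t ^ N + g t = t ^ N * (1 + \<rho> t)"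
proof (cases "t = 0")
  case True
  then show ?thesis using N_pos by (simp add: g_at_0)
next
  case False
  then show ?thesis by (simp add: \<rho>_def distrib_left)
qed

lemma Tg_eq_J: "Tg N a g v r = J (\<lambda>t. val v t ^ N + g (val v t)) r"
  by (simp only: Tg_def J_def slope_def[abs_def] p_def)

lemma Tg_scaled:
  assumes q: "q \<in> strip" and "0 \<le> r"
  shows "Tg N a g (fst q *\<^sub>R snd q) r = fst q * J (source q) r"
proof -
  have "val (fst q *\<^sub>R snd q) t ^ N + g (val (fst q *\<^sub>R snd q) t) = fst q ^ N * source q t" if "t \<in> {0..1}" for t
  proof -
    have "0 \<le> fst q * val (snd q) t"
      using stripD[OF q] profilesD(3) that by simp
    then show ?thesis
      using reaction_eq[of "fst q * val (snd q) t"] by (simp add: source_def power_mult_distrib mult.assoc)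
  qed
  then have "Tg N a g (fst q *\<^sub>R snd q) r = J (\<lambda>t. fst q ^ N * source q t) r"
    unfolding Tg_eq_J using \<open>0 \<le> r\<close> by (intro J_cong)
  then show ?thesis
    using J_cmult[OF stripD(1)[OF q]] by simp
qed

lemma param_solution:
  assumes q: "q \<in> fixed_points"
  shows "param q \<in> solutions N a g"
proof -
  have qd: "q \<in> strip" using q by (simp add: fixed_points_def)
  have "fst q *\<^sub>R snd q \<in> Xplus"
    using stripD[OF qd] profilesD(3) by (simp add: Xplus_def)
  moreover have "val (fst q *\<^sub>R snd q) r = 1 / height q * Tg N a g (fst q *\<^sub>R snd q) r" if "r \<in> {0..1}" for r
    using that fixed_point_eq[OF q that] by (simp add: Tg_scaled[OF qd])
  ultimately show ?thesis
    by (simp add: solutions_def param_def)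
qed

lemma param_Pplus:
  assumes q: "q \<in> strip" and "0 < fst q"
  shows "snd (param q) \<in> Pplus"
proof -
  have "0 < val (snd q) r" if "r \<in> {0<..<1}" for r
    using profilesD(1)[OF stripD(2)[OF q], of r] that by simp
  then show ?thesis
    using assms profilesD(3)[OF stripD(2)[OF q]] by (simp add: param_def Pplus_def Xplus_def)
qed

text \<open>A nontrivial nonnegative solution forces a positive parameter, hence decreases from its
  maximum \<open>s\<close> at 0 and satisfies the chord estimate; \<open>v\<close> divided by
  \<open>s\<close> is therefore a profile, and the factor \<open>s\<close> cancels from the
  equation.\<close>

lemma solution_param:
  assumes sol: "(\<mu>, v) \<in> solutions N a g" and nontriv: "v \<noteq> 0"
  shows "\<exists>q\<in>fixed_points. param q = (\<mu>, v)"
proof -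
  define f where "f = (\<lambda>t. val v t ^ N + g (val v t))"
  have "v \<in> Xplus"
    using sol by (simp add: solutions_def)
  then have v0: "0 \<le> val v r" if "r \<in> {0..1}" for r
    using that by (simp add: Xplus_def)
  have veq: "val v r = \<mu> * J f r" if "r \<in> {0..1}" for r
    using sol that by (simp add: solutions_def Tg_eq_J f_def)
  have "continuous_on {0..1} f"
    unfolding f_def using v0
    by (intro continuous_intros continuous_on_val continuous_on_compose2[OF g_cont continuous_on_val]) auto
  then have f: "nonneg_cont f"
    using v0 g_nonneg by (simp add: nonneg_cont_def f_def)
  have "\<exists>x\<in>{0..1}. val v x \<noteq> val 0 x"
    by (rule ccontr) (use C01_eqI[of v 0] nontriv in blast)
  then obtain x where x: "x \<in> {0..1}" and nz: "val v x \<noteq> val 0 x"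
    by blast
  then have vx: "0 < val v x"
    using v0[OF x] by simp
  then have "0 < \<mu> * J f x" "0 \<le> J f x"
    using veq[OF x] J_nonneg[OF f x] by simp_all
  then have \<mu>: "0 < \<mu>"
    by (simp add: zero_less_mult_iff)
  define s where "s = val v 0"
  have le: "val v r \<le> s" if "r \<in> {0..1}" for r
    using veq[of r] veq[of 0] J_lip1(1)[OF f, of 0 r] that \<mu> by (simp add: s_def)
  have ge: "(1 - r) * s \<le> val v r" if "r \<in> {0..1}" for r
    using veq[of r] veq[of 0] J_chord[OF f, of r] that \<mu> by (simp add: s_def mult.left_commute)
  have s: "0 < s"
    using le[OF x] vx by simp
  define w where "w = (1 / s) *\<^sub>R v"
  have w: "w \<in> profiles"
    using le ge s by (auto simp: profiles_def w_def field_simps)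
  have vw: "v = s *\<^sub>R w"
    using s by (simp add: w_def)
  have qd: "(s, w) \<in> strip"
    using s w by (simp add: strip_def)
  have weq: "val w r = \<mu> * J (source (s, w)) r" if r: "r \<in> {0..1}" for r
  proof -
    have "s * val w r = \<mu> * (s * J (source (s, w)) r)"
      using veq[OF r] Tg_scaled[OF qd, of r] r by (simp add: f_def Tg_eq_J flip: vw) (simp add: vw)
    then show ?thesis using s by simp
  qed
  have "1 = \<mu> * height (s, w)"
    using weq[of 0] profile_at_0[OF w] by (simp add: height_def)
  then have \<mu>eq: "\<mu> = 1 / height (s, w)"
    using height_pos[OF qd] by (simp add: field_simps)
  have "F (s, w) = w"
    using weq by (intro C01_eqI) (simp add: val_F[OF qd] \<mu>eq)
  then show ?thesis
    using qd by (intro bexI[of _ "(s, w)"]) (auto simp: fixed_points_def param_def \<mu>eq vw)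
qed

text \<open>The fixed point equation is the twice integrated boundary value problem; the fundamental
  theorem of calculus undoes the outer and then the inner integral.\<close>

lemma fixed_point_at_0_eigenvalue:
  assumes q: "(0, w) \<in> fixed_points"
  shows "eigenvalue N a (1 / height (0, w))"
proof -
  have qd: "(0, w) \<in> strip" and w: "w \<in> profiles"
    using q by (auto simp: fixed_points_def strip_def)
  define \<mu> where "\<mu> = 1 / height (0, w)"
  define u where "u = (\<lambda>t. val w t ^ N)"
  have \<mu>: "0 < \<mu>" using height_pos[OF qd] by (simp add: \<mu>_def)
  have u: "nonneg_cont u"
    using source_nc[OF qd] by (simp add: source_at_0 u_def)
  note uc = nonneg_cont_D(1)[OF u]
  define v where "v = (\<lambda>r. \<mu> * J u r)"
  have veq: "v r = val w r" if "r \<in> {0..1}" for r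
    using fixed_point_eq[OF q that] by (simp add: source_at_0 v_def \<mu>_def u_def)
  define v' where "v' = (\<lambda>r. - \<mu> * slope u r)"
  have "eigen_solution N a \<mu> v"
    unfolding eigen_solution_def
  proof (intro exI[of _ v'] conjI ballI)
    show "continuous_on {0..1} v'"
      unfolding v'_def by (intro continuous_intros slope_cont uc)
    show "v' 0 = 0" "v 1 = 0"
      by (simp_all add: v'_def v_def slope_def)
    fix r :: real assume r: "r \<in> {0..1}"
    have "((\<lambda>x. integral {0..x} (slope u)) has_real_derivative slope u r) (at r within {0..1})"
      by (rule integral_has_real_derivative[OF slope_cont[OF uc] r])
    then have "((\<lambda>x. \<mu> * (J u 0 - integral {0..x} (slope u))) has_real_derivative \<mu> * (0 - slope u r)) (at r within {0..1})"
      by (intro DERIV_cmult DERIV_diff DERIV_const)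
    moreover have "\<mu> * (J u 0 - integral {0..x} (slope u)) = v x" if "x \<in> {0..1}" for x
      using J_split[OF uc, of 0 x] that by (simp add: v_def)
    ultimately show "(v has_real_derivative v' r) (at r within {0..1})"
      using r by (auto simp: v'_def intro: has_field_derivative_transform_within[OF _ zero_less_one])
  next
    fix r :: real assume r: "r \<in> {0<..<1}"
    have "((\<lambda>x. integral {0..x} (\<lambda>t. p t * u t)) has_real_derivative p r * u r) (at r within {0..1})"
      using r by (intro integral_has_real_derivative cont_pu uc) auto
    then have "((\<lambda>x. \<mu> ^ N * integral {0..x} (\<lambda>t. p t * u t)) has_real_derivative \<mu> ^ N * (p r * u r)) (at r)"
      using r by (intro DERIV_cmult) (simp add: at_within_Icc_at)
    moreover have "\<mu> ^ N * integral {0..x} (\<lambda>t. p t * u t) = (- v' x) ^ N" if "x \<in> {0<..<1}" for x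
      using slope_power[OF u, of x] that by (simp add: v'_def power_mult_distrib)
    moreover have "\<mu> ^ N * (p r * u r) = \<mu> ^ N * real N * r ^ (N - 1) * a r * v r ^ N"
      using veq[of r] r by (simp add: p_def u_def)
    ultimately show "((\<lambda>t. (- v' t) ^ N) has_real_derivative \<mu> ^ N * real N * r ^ (N - 1) * a r * v r ^ N) (at r)"
      using r by (auto intro: has_field_derivative_transform_within_open[of _ _ _ "{0<..<1}"])
  qed
  moreover have "v 0 \<noteq> 0"
    using veq[of 0] profile_at_0[OF w] by simp
  ultimately show ?thesis
    unfolding eigenvalue_def \<mu>_def by force
qed

text \<open>The absolute value of an eigenfunction of arbitrary sign is a subsolution; for even
  \<^term>\<open>N\<close> the sign of the derivative is not determined by the equation, but only
  its modulus is needed.\<close>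

lemma eigen_solution_subsolution:
  assumes ev: "eigen_solution N a \<mu> v" and "0 < \<mu>" and r: "r \<in> {0..1}"
  shows "continuous_on {0..1} v" "\<bar>v r\<bar> \<le> \<mu> * J (\<lambda>t. \<bar>v t\<bar> ^ N) r"
proof -
  obtain v' where v'c: "continuous_on {0..1} v'"
    and v': "\<And>r. r \<in> {0..1} \<Longrightarrow> (v has_real_derivative v' r) (at r within {0..1})"
    and eq: "\<And>r. r \<in> {0<..<1} \<Longrightarrow> ((\<lambda>t. (- v' t) ^ N) has_real_derivative
       \<mu> ^ N * real N * r ^ (N - 1) * a r * v r ^ N) (at r)"
    and bc: "v' 0 = 0" "v 1 = 0"
    using ev unfolding eigen_solution_def by blast
  show vc: "continuous_on {0..1} v"
    using v' by (rule DERIV_continuous_on)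
  define u where "u = (\<lambda>t. \<bar>v t\<bar> ^ N)"
  have u: "nonneg_cont u"
    unfolding u_def nonneg_cont_def using vc by (auto intro: continuous_intros)
  note uc = nonneg_cont_D(1)[OF u]
  have slope: "\<bar>v' x\<bar> \<le> \<mu> * slope u x" if x: "x \<in> {0..1}" for x
  proof -
    \<comment> \<open>The equation is known only in the open interval, so the version of the
      fundamental theorem with interior differentiability and continuity up to the ends is
      used.\<close>
    have "((\<lambda>t. \<mu> ^ N * (p t * v t ^ N)) has_integral (- v' x) ^ N - (- v' 0) ^ N) {0..x}"
    proof (rule fundamental_theorem_of_calculus_interior)
      show "continuous_on {0..x} (\<lambda>t. (- v' t) ^ N)"
        using v'c x by (auto intro!: continuous_intros intro: continuous_on_subset)
      show "((\<lambda>t. (- v' t) ^ N) has_vector_derivative \<mu> ^ N * (p t * v t ^ N)) (at t)" if "t \<in> {0<..<x}" for t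
        using eq[of t] that x by (simp add: p_def mult_ac flip: has_real_derivative_iff_has_vector_derivative)
    qed (use x in auto)
    then have int: "((\<lambda>t. \<mu> ^ N * (p t * v t ^ N)) has_integral (- v' x) ^ N) {0..x}"
      using bc(1) N1 by (simp add: power_0_left)
    have pu: "(\<lambda>t. p t * u t) integrable_on {0..x}"
      using x by (intro int_pu uc) auto
    have "\<bar>v' x\<bar> ^ N = norm (integral {0..x} (\<lambda>t. \<mu> ^ N * (p t * v t ^ N)))"
      using integral_unique[OF int] by (simp add: power_abs)
    also have "\<dots> \<le> integral {0..x} (\<lambda>t. \<mu> ^ N * (p t * u t))"
    proof (rule integral_norm_bound_integral)
      show "norm (\<mu> ^ N * (p t * v t ^ N)) \<le> \<mu> ^ N * (p t * u t)" if "t \<in> {0..x}" for t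
        using \<open>0 < \<mu>\<close> p_nonneg[of t] that x by (simp add: abs_mult u_def power_abs)
    qed (use int pu in \<open>auto intro: integrable_on_mult_right\<close>)
    also have "\<dots> = (\<mu> * slope u x) ^ N"
      using slope_power[OF u x] by (simp add: power_mult_distrib)
    finally show ?thesis
      using slope_nonneg[OF u x] \<open>0 < \<mu>\<close> N_pos by (subst (asm) power_mono_iff) auto
  qed
  have "(v' has_integral v 1 - v r) {r..1}"
    using r by (intro fundamental_theorem_of_calculus)
      (auto simp flip: has_real_derivative_iff_has_vector_derivative intro: DERIV_subset[OF v'])
  then have int: "(v' has_integral - v r) {r..1}"
    using bc(2) by simp
  have "\<bar>v r\<bar> = norm (integral {r..1} v')"
    using integral_unique[OF int] by simp
  also have "\<dots> \<le> integral {r..1} (\<lambda>s. \<mu> * slope u s)"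
    by (rule integral_norm_bound_integral)
      (use int r slope in \<open>auto intro!: integrable_on_mult_right slope_int uc\<close>)
  also have "\<dots> = \<mu> * J u r"
    by (simp add: J_def)
  finally show "\<bar>v r\<bar> \<le> \<mu> * J (\<lambda>t. \<bar>v t\<bar> ^ N) r"
    by (simp add: u_def)
qed

text \<open>The minimum is attained: the positive fixed point gives an eigenvalue, and the absolute
  value of any other eigenfunction is a subsolution, to which the comparison applies.\<close>

lemma first_eigenvalue_eq:
  assumes q: "(0, w) \<in> fixed_points"
  shows "first_eigenvalue N a = 1 / height (0, w)"
  unfolding first_eigenvalue_def
proof (rule Least_equality)
  have "(0, w) \<in> strip" using q by (simp add: fixed_points_def)
  then show "0 < 1 / height (0, w) \<and> eigenvalue N a (1 / height (0, w))"
    using fixed_point_at_0_eigenvalue[OF q] height_pos by simp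
  fix \<mu> assume "0 < \<mu> \<and> eigenvalue N a \<mu>"
  then obtain v x where "0 < \<mu>" and ev: "eigen_solution N a \<mu> v" and x: "x \<in> {0..1}" "v x \<noteq> 0"
    by (auto simp: eigenvalue_def)
  note sub = eigen_solution_subsolution[OF ev \<open>0 < \<mu>\<close>]
  show "1 / height (0, w) \<le> \<mu>"
  proof (rule fixed_point_at_0_minimal[OF q, of "\<lambda>t. \<bar>v t\<bar>" x])
    show "nonneg_cont (\<lambda>t. \<bar>v t\<bar>)"
      using sub(1)[of 0] by (auto simp: nonneg_cont_def intro: continuous_intros)
  qed (use x sub(2) \<open>0 < \<mu>\<close> in auto)
qed

lemma first_eigenpair:
  obtains w where "(0, w) \<in> fixed_points" "param (0, w) = (first_eigenvalue N a, 0)"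
    "\<And>q. q \<in> fixed_points \<Longrightarrow> fst q = 0 \<Longrightarrow> q = (0, w)"
proof -
  \<comment> \<open>The degenerate range \<open>R = 0\<close> of the continuum theorem yields
    existence of the positive eigenfunction.\<close>
  obtain w where w: "(0, w) \<in> fixed_points"
    using fixed_points_continuum[of 0] by blast
  show thesis
  proof (rule that[OF w])
    show "param (0, w) = (first_eigenvalue N a, 0)"
      by (simp add: param_def first_eigenvalue_eq[OF w])
    show "q = (0, w)" if "q \<in> fixed_points" "fst q = 0" for q
      using that fixed_point_at_0_unique[OF _ w] by (cases q) auto
  qed
qed

text \<open>Every connected set joining amplitude 0 to amplitude \<open>R\<close> contains the
  unique \<open>(0, w)\<close>, so all of them lie in its component \<open>C0\<close>. Properness
  makes the image closed, and unbounded amplitudes make it unbounded.\<close>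

lemma unbounded_solution_continuum:
  "\<exists>C. closed C \<and> connected C \<and> \<not> bounded C \<and> (first_eigenvalue N a, 0) \<in> C \<and>
    C \<subseteq> Kplus \<union> {(first_eigenvalue N a, 0)} \<and> C \<subseteq> solutions N a g"
proof -
  obtain w where w: "(0, w) \<in> fixed_points" and pw: "param (0, w) = (first_eigenvalue N a, 0)"
    and uniq: "\<And>q. q \<in> fixed_points \<Longrightarrow> fst q = 0 \<Longrightarrow> q = (0, w)"
    using first_eigenpair by blast
  define C0 where "C0 = connected_component_set fixed_points (0, w)"
  have C0: "C0 \<subseteq> fixed_points" "connected C0" "(0, w) \<in> C0"
    using w by (auto simp: C0_def connected_component_subset connected_connected_component connected_component_refl)
  have clC0: "closed C0"
    unfolding C0_def by (rule closed_connected_component[OF closed_fixed_points])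
  have C0d: "C0 \<subseteq> strip"
    using C0(1) by (auto simp: fixed_points_def)
  have reach: "\<exists>x. (R, x) \<in> C0" if R: "0 \<le> R" for R
  proof -
    obtain C x y where C: "connected C" "C \<subseteq> fixed_points" "(0, x) \<in> C" "(R, y) \<in> C"
      using fixed_points_continuum[OF R] by blast
    have "(0, x) = (0, w)"
      using uniq C by auto
    then have "C \<subseteq> C0"
      unfolding C0_def using C by (intro connected_component_maximal) auto
    then show ?thesis using C(4) by blast
  qed
  show ?thesis
  proof (intro exI[of _ "param ` C0"] conjI)
    show "closed (param ` C0)"
      unfolding closed_sequential_limits
    proof (intro allI impI, elim conjE)
      fix y l assume y: "\<forall>n. y n \<in> param ` C0" and l: "y \<longlonglongrightarrow> l"
      from y have "\<forall>n. \<exists>q. q \<in> C0 \<and> y n = param q"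
        by blast
      then obtain q where q: "\<And>n. q n \<in> C0" and yq: "\<And>n. y n = param (q n)"
        by metis
      have "(\<lambda>n. param (q n)) \<longlonglongrightarrow> l"
        using l by (simp flip: yq)
      then obtain q' k where "(q \<circ> k) \<longlonglongrightarrow> q'" "param q' = l"
        using param_proper[of q l] C0(1) q by blast
      moreover from this have "q' \<in> C0"
        using closed_sequentially[OF clC0] q by (metis comp_apply)
      ultimately show "l \<in> param ` C0" by blast
    qed
    show "connected (param ` C0)"
      by (intro connected_continuous_image continuous_on_subset[OF param_cont] C0d C0)
    show "\<not> bounded (param ` C0)"
    proof
      assume "bounded (param ` C0)"
      then obtain B where B: "\<And>q. q \<in> C0 \<Longrightarrow> norm (param q) \<le> B"
        unfolding bounded_iff by blast
      obtain x where x: "(\<bar>B\<bar> + 1, x) \<in> C0"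
        using reach[of "\<bar>B\<bar> + 1"] by auto
      have "\<bar>B\<bar> + 1 = norm (snd (param (\<bar>B\<bar> + 1, x)))"
        using norm_snd_param[of "(\<bar>B\<bar> + 1, x)"] x C0d by auto
      also have "\<dots> \<le> norm (param (\<bar>B\<bar> + 1, x))"
        using norm_snd_le[of "snd (param (\<bar>B\<bar> + 1, x))" "fst (param (\<bar>B\<bar> + 1, x))"] by simp
      also have "\<dots> \<le> B"
        using B x by blast
      finally show False by simp
    qed
    show "(first_eigenvalue N a, 0) \<in> param ` C0"
      using C0(3) pw by force
    show "param ` C0 \<subseteq> Kplus \<union> {(first_eigenvalue N a, 0)}"
    proof (rule image_subsetI)
      fix q assume q: "q \<in> C0"
      then have qd: "q \<in> strip" and qf: "q \<in> fixed_points" using C0d C0(1) by auto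
      show "param q \<in> Kplus \<union> {(first_eigenvalue N a, 0)}"
      proof (cases "fst q = 0")
        case True
        then show ?thesis using uniq[OF qf] pw by simp
      next
        case False
        then have "snd (param q) \<in> Pplus"
          using param_Pplus[OF qd] stripD(1)[OF qd] by simp
        then show ?thesis by (cases "param q") (simp add: Kplus_def)
      qed
    qed
    show "param ` C0 \<subseteq> solutions N a g"
      using param_solution C0(1) by blast
  qed
qed

text \<open>Properness lifts a sequence of positive solutions tending to \<open>(\<mu>, 0)\<close>
  to fixed points clustering at amplitude 0, where only \<open>(0, w)\<close> is available.
  Conversely, fixed points with amplitudes tending to 0 cluster at the same point.\<close>

lemma bifurcation_point_iff: "bifurcation_point N a g (\<mu>, 0) \<longleftrightarrow> \<mu> = first_eigenvalue N a"
proof -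
  obtain w where w: "(0, w) \<in> fixed_points" and pw: "param (0, w) = (first_eigenvalue N a, 0)"
    and uniq: "\<And>q. q \<in> fixed_points \<Longrightarrow> fst q = 0 \<Longrightarrow> q = (0, w)"
    using first_eigenpair by blast
  show ?thesis
  proof
    assume "bifurcation_point N a g (\<mu>, 0)"
    then obtain y where y: "\<And>n. y n \<in> solutions N a g" "\<And>n. snd (y n) \<in> Pplus" and lim: "y \<longlonglongrightarrow> (\<mu>, 0)"
      by (auto simp: bifurcation_point_def)
    have "\<exists>q\<in>fixed_points. param q = y n" for n
    proof -
      have "\<forall>r\<in>{0<..<1}. 0 < val (snd (y n)) r"
        using y(2)[of n] by (simp add: Pplus_def)
      then have "0 < val (snd (y n)) (1/2)"
        by (rule bspec) simp
      then have "snd (y n) \<noteq> 0"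
        by (metis val_0 less_irrefl)
      then show ?thesis
        using solution_param[of "fst (y n)" "snd (y n)"] y(1)[of n] by simp
    qed
    then obtain q where q: "\<And>n. q n \<in> fixed_points" "\<And>n. param (q n) = y n"
      by metis
    then obtain q' where q': "q' \<in> fixed_points" "param q' = (\<mu>, 0)"
      using param_proper[of q "(\<mu>, 0)"] lim by auto
    have "fst q' = 0"
      using norm_snd_param[of q'] q' by (simp add: fixed_points_def)
    then show "\<mu> = first_eigenvalue N a"
      using uniq[OF q'(1)] q'(2) pw by simp
  next
    assume \<mu>: "\<mu> = first_eigenvalue N a"
    \<comment> \<open>Amplitudes \<open>1 / Suc n\<close> are positive, so the solutions lie in
      \<open>Pplus\<close>, and at most 1, so they have a convergent subsequence.\<close>
    have "\<exists>x. (1 / Suc n, x) \<in> fixed_points" for n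
      using fixed_points_continuum[of "1 / Suc n"] by auto
    then obtain x where x: "\<And>n. (1 / Suc n, x n) \<in> fixed_points"
      by metis
    obtain q k where q: "q \<in> fixed_points" and k: "strict_mono k"
      and lim: "((\<lambda>n. (1 / real (Suc n), x n)) \<circ> k) \<longlonglongrightarrow> q"
      using fixed_points_seq_compact[of "\<lambda>n. (1 / real (Suc n), x n)" 1] x by auto
    have "(\<lambda>n. 1 / real (Suc (k n))) \<longlonglongrightarrow> fst q"
      using tendsto_fst[OF lim] by (simp add: o_def)
    moreover have "(\<lambda>n. 1 / real (Suc (k n))) \<longlonglongrightarrow> 0"
      using LIMSEQ_subseq_LIMSEQ[OF LIMSEQ_Suc[OF lim_1_over_n] k] by (simp add: o_def)
    ultimately have "q = (0, w)"
      using uniq[OF q] LIMSEQ_unique by blast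
    then have lim0: "((\<lambda>n. (1 / real (Suc n), x n)) \<circ> k) \<longlonglongrightarrow> (0, w)"
      using lim by simp
    have "(\<lambda>n. param (((\<lambda>n. (1 / real (Suc n), x n)) \<circ> k) n)) \<longlonglongrightarrow> param (0, w)"
      using x w by (intro continuous_on_tendsto_compose[OF param_cont lim0]) (auto simp: fixed_points_def)
    then have "(\<lambda>n. param (1 / real (Suc (k n)), x (k n))) \<longlonglongrightarrow> (\<mu>, 0)"
      by (simp add: pw \<mu>)
    moreover have "param (1 / real (Suc n), x n) \<in> solutions N a g" for n
      using param_solution[OF x] .
    moreover have "snd (param (1 / real (Suc n), x n)) \<in> Pplus" for n
      using x[of n] by (intro param_Pplus) (auto simp: fixed_points_def)
    ultimately show "bifurcation_point N a g (\<mu>, 0)"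
      unfolding bifurcation_point_def by fastforce
  qed
qed

end

theorem theorem4p2:
  fixes N :: nat and a g :: "real \<Rightarrow> real"
  assumes "1 \<le> N"
    and "continuous_on {0..1} a"
    and "\<And>r. r \<in> {0..1} \<Longrightarrow> 0 \<le> a r"
    and "\<And>c d. 0 \<le> c \<Longrightarrow> c < d \<Longrightarrow> d \<le> 1 \<Longrightarrow> \<exists>r\<in>{c<..<d}. a r \<noteq> 0"
    and "continuous_on {0..} g"
    and "\<And>s. 0 \<le> s \<Longrightarrow> 0 \<le> g s"
    and "((\<lambda>s. g s / s ^ N) \<longlongrightarrow> 0) (at_right 0)"
  shows "(\<exists>C :: (real \<times> C01) set.
            closed C \<and> connected C \<and> \<not> bounded C \<and> (first_eigenvalue N a, 0) \<in> C \<and>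
            C \<subseteq> Kplus \<union> {(first_eigenvalue N a, 0)} \<and> C \<subseteq> solutions N a g) \<and>
         (\<forall>\<mu>. bifurcation_point N a g (\<mu>, 0) \<longleftrightarrow> \<mu> = first_eigenvalue N a)"
proof -
  interpret radial_problem N a g
    by (rule radial_problem.intro; fact assms)
  show ?thesis
    using unbounded_solution_continuum bifurcation_point_iff by blast
qed

end
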